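(* Let $\mathcal{P}$ be the class of unimodal probability measures on $\mathbb{R}$ that admit a smooth and bounded density, and let $\mathcal{Q}\subset\mathcal{P}$ be the subclass of those measures whose density is a finite mixture of Gaussian densities. Then the mode functional $\Gamma_{\text{mode}}:\mathcal{Q}\to\mathbb{R}$ has infinite identifiable elicitation complexity with respect to $\mathcal{Q}$. That is, there is no $k\in\mathbb{N}$ for which there exist a property $\hat\Gamma:\mathcal{Q}\to\mathbb{R}^k$ that is both elicitable and identifiable (with respect to $\mathcal{Q}$), and a function $f:\mathbb{R}^k\to\mathbb{R}$ with $\Gamma_{\text{mode}}=f\circ\hat\Gamma$ on $\mathcal{Q}$.
   Context: A property on a class $\mathcal{Q}$ of probability measures on $(\mathcal{Y},\mathcal{F})$ is a map $\Gamma:\mathcal{Q}\to\mathcal{R}$. A property is elicitable if there is a loss function $L:\mathcal{R}\times\mathcal{Y}\to\mathbb{R}$ with $\{\Gamma(P)\}=\arg\min_r E_P L(r,Y)$ for every $P\in\mathcal{Q}$. A property $\Gamma:\mathcal{Q}\to\mathcal{R}\subseteq\mathbb{R}^k$ is identifiable if there is $V:\mathcal{R}\times\mathcal{Y}\to\mathbb{R}^k$ such that for all $P\in\mathcal{Q}$ and $r\in\mathcal{R}$, $\Gamma(P)=r$ if and only if $E_P V(r,Y)=0$. The identifiable elicitation complexity of $\Gamma$ is the least $k$ such that $\Gamma=f\circ\hat\Gamma$ for some elicitable and identifiable $\hat\Gamma:\mathcal{Q}\to\mathbb{R}^k$ and some $f:\mathbb{R}^k\to\mathcal{R}$; it is infinite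 if no such $k$ exists. Mode: for $P$ with distribution function $F$ and $\varepsilon>0$, a modal midpoint $\Gamma_\varepsilon(P)$ is any $x\in\arg\max_x\big(F(x+\varepsilon)-\lim_{z\uparrow x-\varepsilon}F(z)\big)$. If there is a sequence $\varepsilon_n\to0$ and a choice of modal midpoints $\Gamma_{\varepsilon_n}(P)$ converging to a real number, that limit is a mode of $P$ (for a continuous density it is the global maximizer of the density). $P$ is unimodal if its mode is well-defined and unique; $\Gamma_{\text{mode}}(P)$ denotes it. *)

theory Defs
  imports "HOL-Probability.Probability"
begin

text \<open>Modal midpoints: for \<epsilon> > 0, x maximizes F(x+\<epsilon>) - F((x-\<epsilon>)-), which equals
  the probability of the closed interval [x-\<epsilon>, x+\<epsilon>].\<close>
definition modal_midpoint :: "real measure \<Rightarrow> real \<Rightarrow> real \<Rightarrow> bool" where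
  "modal_midpoint P \<epsilon> x \<longleftrightarrow>
     (\<forall>y. measure P {y - \<epsilon> .. y + \<epsilon>} \<le> measure P {x - \<epsilon> .. x + \<epsilon>})"

definition is_mode :: "real measure \<Rightarrow> real \<Rightarrow> bool" where
  "is_mode P m \<longleftrightarrow>
     (\<exists>eps xs. (\<forall>n. eps n > 0) \<and> eps \<longlonglongrightarrow> 0 \<and>
        (\<forall>n. modal_midpoint P (eps n) (xs n)) \<and> xs \<longlonglongrightarrow> m)"

definition unimodal :: "real measure \<Rightarrow> bool" where
  "unimodal P \<longleftrightarrow> (\<exists>!m. is_mode P m)"

definition mode :: "real measure \<Rightarrow> real" where
  "mode P = (THE m. is_mode P m)"

definition gaussian_mixture :: "(real \<Rightarrow> real) \<Rightarrow> bool" where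
  "gaussian_mixture f \<longleftrightarrow>
     (\<exists>(n::nat) w \<mu> \<sigma>. n \<ge> 1 \<and> (\<forall>i<n. w i > 0 \<and> \<sigma> i > 0) \<and> (\<Sum>i<n. w i) = 1 \<and>
        (\<forall>x. f x = (\<Sum>i<n. w i * normal_density (\<mu> i) (\<sigma> i) x)))"

definition class_P :: "real measure set" where
  "class_P = {P. prob_space P \<and> sets P = sets borel \<and> unimodal P \<and>
     (\<exists>f. (\<forall>x. f x \<ge> 0) \<and> bounded (range f) \<and>
          (\<forall>k. \<forall>x. ((deriv ^^ k) f) differentiable (at x)) \<and>
          P = density lborel (\<lambda>x. ennreal (f x)))}"

definition class_Q :: "real measure set" where
  "class_Q = {P \<in> class_P. \<exists>f. gaussian_mixture f \<and> P = density lborel (\<lambda>x. ennreal (f x))}"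

definition elicitable :: "'b measure set \<Rightarrow> ('b measure \<Rightarrow> 'r) \<Rightarrow> bool" where
  "elicitable Q G \<longleftrightarrow>
     (\<exists>L :: 'r \<Rightarrow> 'b \<Rightarrow> real.
        (\<forall>P\<in>Q. \<forall>r. integrable P (L r)) \<and>
        (\<forall>P\<in>Q. {G P} = {r. \<forall>r'. (\<integral>y. L r y \<partial>P) \<le> (\<integral>y. L r' y \<partial>P)}))"

definition identifiable :: "'b measure set \<Rightarrow> ('b measure \<Rightarrow> 'r::euclidean_space) \<Rightarrow> bool" where
  "identifiable Q G \<longleftrightarrow>
     (\<exists>V :: 'r \<Rightarrow> 'b \<Rightarrow> 'r.
        (\<forall>P\<in>Q. \<forall>r. integrable P (V r)) \<and>
        (\<forall>P\<in>Q. \<forall>r. G P = r \<longleftrightarrow> (\<integral>y. V r y \<partial>P) = 0))"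

end

theory Submission
  imports Defs
begin

text \<open>
  Mixtures of the Gaussians \<open>N(\<mu>,1)\<close> with \<open>\<bar>\<mu>\<bar> < 1/2\<close> are all unimodal. On the cone of their weight vectors
  an elicitable property \<open>R\<close> selects the minimizer of a family of linear functionals, so \<open>R x = R y\<close> iff
  the concave minimum is additive on \<open>x, y\<close>; hence the relation \<open>R x = R y\<close> is closed. Each level set of
  an identifiable property is cut out by at most \<open>k\<close> linear equations with coefficients
  \<open>v \<mu> r\<close>, the expectation of \<open>V r\<close> under \<open>N(\<mu>,1)\<close>. Choose a weight \<open>q\<close>, with \<open>r = R q\<close>, for which the
  vectors \<open>v \<mu> r\<close>, \<open>\<mu>\<close> in the support of \<open>q\<close>, have the largest possible rank. Approximating \<open>q\<close> by weights that also charge a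
  further \<open>\<mu>\<close> and using closedness, \<open>v \<mu> r\<close> lies in the span of these vectors for every \<open>\<mu>\<close>. Thus \<open>q\<close> can be
  perturbed in the direction of every \<open>N(\<mu>,1)\<close> without changing \<open>R\<close>, and so without changing the
  mode \<open>m\<close>. Since \<open>m\<close> is a critical point of all these densities, the derivative at \<open>m\<close> of the density of
  \<open>N(\<mu>,1)\<close> is a fixed linear functional of \<open>v \<mu> r\<close>, that is, the expectation under \<open>N(\<mu>,1)\<close> of a fixed function \<open>u\<close>. This
  would make \<open>u\<close> the derivative of a Dirac distribution: the Laplace transform of \<open>u\<close> times the standard normal density,
  taken about \<open>m\<close>, is affine and non-constant near \<open>0\<close>, hence everywhere, whereas it is bounded on the imaginary axis.
\<close>

section \<open>Properties on a cone of weights\<close>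

definition supp :: "('i \<Rightarrow> real) \<Rightarrow> 'i set" where
  "supp w = {i. w i \<noteq> 0}"

text \<open>Weights are not normalized: argmin conditions and linear level equations are invariant
  under positive scaling. So sums of weights stay in the cone, and small perturbations need only be
  kept nonnegative.\<close>

definition weight_cone :: "'i set \<Rightarrow> ('i \<Rightarrow> real) set" where
  "weight_cone I = {w. finite (supp w) \<and> supp w \<subseteq> I \<and> supp w \<noteq> {} \<and> (\<forall>i. 0 \<le> w i)}"

section \<open>Finite sums and subsequences in finitely many coordinates\<close>

lemma sum_supp_superset:
  fixes x :: "'i \<Rightarrow> 'b::real_vector"
  assumes "finite T" "supp w \<subseteq> T"
  shows "(\<Sum>i\<in>supp w. w i *\<^sub>R x i) = (\<Sum>i\<in>T. w i *\<^sub>R x i)"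
  using assms by (intro sum.mono_neutral_left) (auto simp: supp_def)

text \<open>Bolzano-Weierstrass, one coordinate at a time: each new coordinate costs a further
  subsequence, which keeps the limits found so far.\<close>

lemma convergent_subsequence_coordinates:
  fixes u :: "nat \<Rightarrow> 'i \<Rightarrow> real"
  assumes "finite A" "\<And>n i. i \<in> A \<Longrightarrow> \<bar>u n i\<bar> \<le> B"
  obtains s l where "strict_mono (s :: nat \<Rightarrow> nat)" "\<And>i. i \<in> A \<Longrightarrow> (\<lambda>n. u (s n) i) \<longlonglongrightarrow> l i"
proof -
  have "\<exists>s l. strict_mono (s :: nat \<Rightarrow> nat) \<and> (\<forall>i\<in>A. (\<lambda>n. u (s n) i) \<longlonglongrightarrow> l i)"
    using assms
  proof (induction A rule: finite_induct)
    case empty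
    have "strict_mono (id :: nat \<Rightarrow> nat)"
      by (simp add: strict_mono_def)
    then show ?case by blast
  next
    case (insert j A)
    then obtain s l where s: "strict_mono (s :: nat \<Rightarrow> nat)" "\<forall>i\<in>A. (\<lambda>n. u (s n) i) \<longlonglongrightarrow> l i"
      by auto
    have "bounded (range (\<lambda>n. u (s n) j))"
      using insert.prems by (intro boundedI[of _ B]) auto
    then obtain l' s' where s': "strict_mono (s' :: nat \<Rightarrow> nat)" "((\<lambda>n. u (s n) j) \<circ> s') \<longlonglongrightarrow> l'"
      using bounded_imp_convergent_subsequence by blast
    have "(\<lambda>n. u ((s \<circ> s') n) i) \<longlonglongrightarrow> (l(j := l')) i" if "i \<in> insert j A" for i
    proof (cases "i = j")
      case True
      then show ?thesis using s'(2) by (simp add: o_def)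
    next
      case False
      then have "((\<lambda>n. u (s n) i) \<circ> s') \<longlonglongrightarrow> l i"
        using s(2) s'(1) that LIMSEQ_subseq_LIMSEQ by blast
      then show ?thesis using False by (simp add: o_def)
    qed
    moreover have "strict_mono (s \<circ> s')"
      using s(1) s'(1) by (rule strict_mono_o)
    ultimately show ?case by blast
  qed
  then show thesis using that by blast
qed

section \<open>Linear independence of indexed families\<close>

definition indexed_independent :: "('i \<Rightarrow> 'e::real_vector) \<Rightarrow> 'i set \<Rightarrow> bool" where
  "indexed_independent x J \<longleftrightarrow> (\<forall>c. (\<Sum>j\<in>J. c j *\<^sub>R x j) = 0 \<longrightarrow> (\<forall>j\<in>J. c j = 0))"

text \<open>A value taken at two indices gives the relation with coefficients 1 and -1, so a family
  with repetitions counts as dependent.\<close>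

lemma indexed_independent_inj_on:
  assumes "finite J" "indexed_independent x J"
  shows "inj_on x J"
proof (rule inj_onI, rule ccontr)
  fix i j assume ij: "i \<in> J" "j \<in> J" "x i = x j" "i \<noteq> j"
  define c where "c k = (if k = i then 1 else if k = j then -1 else (0::real))" for k
  have "(\<Sum>k\<in>J. c k *\<^sub>R x k) = (\<Sum>k\<in>{i,j}. c k *\<^sub>R x k)"
    using assms ij by (intro sum.mono_neutral_right) (auto simp: c_def)
  also have "\<dots> = 0" using ij by (simp add: c_def)
  finally have "c i = 0" using assms(2) ij(1) unfolding indexed_independent_def by blast
  then show False by (simp add: c_def)
qed

lemma indexed_independent_independent:
  assumes "finite J" "indexed_independent x J"
  shows "independent (x ` J)"
proof (rule independent_if_scalars_zero)
  show "finite (x ` J)" using assms by simp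
next
  fix f y assume f: "(\<Sum>y\<in>x ` J. f y *\<^sub>R y) = 0" and y: "y \<in> x ` J"
  have "(\<Sum>j\<in>J. f (x j) *\<^sub>R x j) = 0"
    using f sum.reindex[OF indexed_independent_inj_on[OF assms], of "\<lambda>y. f y *\<^sub>R y"] by simp
  then show "f y = 0" using assms(2) y unfolding indexed_independent_def by auto
qed

lemma indexed_independent_card_le:
  fixes x :: "'i \<Rightarrow> 'e::euclidean_space"
  assumes "finite J" "indexed_independent x J"
  shows "card J \<le> DIM('e)"
  using independent_bound[OF indexed_independent_independent[OF assms]]
    card_image[OF indexed_independent_inj_on[OF assms]] by simp

text \<open>Unit l1 norm keeps the coefficients in a compact set away from 0, so limits of such
  relations are again nontrivial. The sign at \<open>g\<close> can be chosen freely because a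
  relation may be negated.\<close>

lemma not_indexed_independentE:
  assumes "finite J" "\<not> indexed_independent x J"
  obtains c where "(\<Sum>j\<in>J. c j *\<^sub>R x j) = 0" "\<And>j. j \<notin> J \<Longrightarrow> c j = 0" "(\<Sum>j\<in>J. \<bar>c j\<bar>) = 1" "0 \<le> c g"
proof -
  obtain c i where c: "(\<Sum>j\<in>J. c j *\<^sub>R x j) = 0" and i: "i \<in> J" "c i \<noteq> 0"
    using assms(2) unfolding indexed_independent_def by blast
  define s where "s = (\<Sum>j\<in>J. \<bar>c j\<bar>)"
  have s: "s > 0"
    using i assms(1) unfolding s_def by (intro sum_pos2[of _ i]) auto
  define k where "k = (if c g \<ge> 0 then 1 / s else - 1 / s)"
  have k: "\<bar>k\<bar> = 1 / s" "k * c g \<ge> 0"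
    using s by (auto simp: k_def divide_nonpos_nonneg)
  define d where "d j = (if j \<in> J then k * c j else 0)" for j
  have "(\<Sum>j\<in>J. d j *\<^sub>R x j) = k *\<^sub>R (\<Sum>j\<in>J. c j *\<^sub>R x j)"
    by (simp add: d_def scaleR_sum_right)
  moreover have "(\<Sum>j\<in>J. \<bar>d j\<bar>) = 1"
  proof -
    have "(\<Sum>j\<in>J. \<bar>d j\<bar>) = (\<Sum>j\<in>J. \<bar>k\<bar> * \<bar>c j\<bar>)"
      by (simp add: d_def abs_mult)
    also have "\<dots> = \<bar>k\<bar> * s" by (simp add: s_def sum_distrib_left)
    finally show ?thesis using k s by simp
  qed
  ultimately show thesis
    using k by (intro that[of d]) (auto simp: c d_def)
qed

text \<open>Abstract form of an elicitable and identifiable property restricted to mixtures: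
  \<open>a i r\<close> and \<open>v i r\<close> stand for the expectations, under the component
  \<open>i\<close>, of the loss and of the identification function at the report
  \<open>r\<close>.\<close>

locale cone_property =
  fixes I :: "'i set" and a :: "'i \<Rightarrow> 'r \<Rightarrow> real" and v :: "'i \<Rightarrow> 'r \<Rightarrow> 'e::euclidean_space"
    and R :: "('i \<Rightarrow> real) \<Rightarrow> 'r"
  assumes minimal: "w \<in> weight_cone I \<Longrightarrow>
      (\<Sum>i\<in>supp w. w i *\<^sub>R a i (R w)) \<le> (\<Sum>i\<in>supp w. w i *\<^sub>R a i r)"
    and minimizer_unique: "w \<in> weight_cone I \<Longrightarrow>
      (\<And>r'. (\<Sum>i\<in>supp w. w i *\<^sub>R a i r) \<le> (\<Sum>i\<in>supp w. w i *\<^sub>R a i r')) \<Longrightarrow> r = R w"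
    and level_set: "w \<in> weight_cone I \<Longrightarrow> R w = r \<longleftrightarrow> (\<Sum>i\<in>supp w. w i *\<^sub>R v i r) = 0"
begin

text \<open>Equality of \<open>R\<close> at two weights means that the concave function
  \<open>w \<mapsto> min r. \<Sum>i. w i * a i r\<close> is additive on them, and this function is continuous on simplicial cones.\<close>
lemma level_relation_closed:
  assumes T: "finite T" "T \<subseteq> I"
    and xn: "\<And>n. x n \<in> weight_cone I" "\<And>n. supp (x n) \<subseteq> T"
    and yn: "\<And>n. y n \<in> weight_cone I" "\<And>n. supp (y n) \<subseteq> T"
    and x': "x' \<in> weight_cone I" "supp x' \<subseteq> T"
    and y': "y' \<in> weight_cone I" "supp y' \<subseteq> T"
    and limx: "\<And>i. i \<in> T \<Longrightarrow> (\<lambda>n. x n i) \<longlonglongrightarrow> x' i"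
    and limy: "\<And>i. i \<in> T \<Longrightarrow> (\<lambda>n. y n i) \<longlonglongrightarrow> y' i"
    and eq: "\<And>n. R (x n) = R (y n)"
  shows "R x' = R y'"
proof -
  define pair where "pair w r = (\<Sum>i\<in>T. w i * a i r)" for w r
  have pair: "(\<Sum>i\<in>supp w. w i *\<^sub>R a i r) = pair w r" if "supp w \<subseteq> T" for w r
    using sum_supp_superset[OF T(1) that, of "\<lambda>i. a i r"] by (simp add: pair_def)
  have le: "pair w (R w) \<le> pair w r" if "w \<in> weight_cone I" "supp w \<subseteq> T" for w r
    using minimal[OF that(1)] pair[OF that(2)] by simp
  have uniq: "r = R w" if "w \<in> weight_cone I" "supp w \<subseteq> T" "pair w r \<le> pair w (R w)" for w r
  proof (rule minimizer_unique[OF that(1)])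
    fix r' show "(\<Sum>i\<in>supp w. w i *\<^sub>R a i r) \<le> (\<Sum>i\<in>supp w. w i *\<^sub>R a i r')"
      unfolding pair[OF that(2)] using that(3) le[OF that(1,2), of r'] by simp
  qed
  \<comment> \<open>The minimum of \<open>a i\<close> over all reports, attained at the unit weight
    on \<open>i\<close>. It bounds \<open>a i\<close> from below uniformly in the report.\<close>
  define h where "h i = a i (R (\<lambda>j. if j = i then 1 else 0))" for i
  have h: "h i \<le> a i r" if "i \<in> T" for i r
  proof -
    let ?e = "\<lambda>j. if j = i then 1 else (0::real)"
    have supp: "supp ?e = {i}" by (auto simp: supp_def)
    then have "?e \<in> weight_cone I" using that T by (auto simp: weight_cone_def)
    from minimal[OF this, of r] show ?thesis by (simp add: supp h_def)
  qed
  define z where "z i = x' i + y' i" for i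
  have supp_z: "supp z \<subseteq> supp x' \<union> supp y'" by (auto simp: z_def supp_def)
  have nonneg: "x' i \<ge> 0" "y' i \<ge> 0" for i using x' y' by (auto simp: weight_cone_def)
  have "supp x' \<subseteq> supp z"
    using nonneg by (auto simp: z_def supp_def) (metis add_nonneg_eq_0_iff)
  then have z: "z \<in> weight_cone I" "supp z \<subseteq> T"
    using supp_z x' y' T finite_subset[OF supp_z] nonneg by (auto simp: weight_cone_def z_def)
  \<comment> \<open>Lower semicontinuity of the minimum at \<open>z\<close>: eventually
    \<open>x n + y n\<close> dominates \<open>\<theta> * z\<close>, and the remainder is bounded
    below through \<open>h\<close>. The common report of \<open>x n\<close> and \<open>y n\<close>
    is what lets their two minima be added under a single report.\<close>
  have theta: "\<theta> * pair z (R z) + (1 - \<theta>) * (\<Sum>i\<in>T. z i * h i) \<le> pair x' (R x') + pair y' (R y')"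
    if th: "0 < \<theta>" "\<theta> < 1" for \<theta>
  proof -
    have "\<forall>\<^sub>F n in sequentially. \<theta> * z i \<le> x n i + y n i" if "i \<in> T" for i
    \<comment> \<open>Where \<open>z i\<close> vanishes, nonnegativity suffices; elsewhere
      \<open>\<theta> < 1\<close> leaves strict room for the limit argument.\<close>
    proof (cases "z i = 0")
      case True
      then show ?thesis using xn(1) yn(1) by (auto simp: weight_cone_def)
    next
      case False
      then have "z i > 0" using nonneg[of i] by (auto simp: z_def)
      then have "\<theta> * z i < z i" using th by simp
      moreover have "(\<lambda>n. x n i + y n i) \<longlonglongrightarrow> z i"
        unfolding z_def by (intro tendsto_add limx limy that)
      ultimately have "\<forall>\<^sub>F n in sequentially. \<theta> * z i < x n i + y n i"
        by (rule order_tendstoD(1)[rotated])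
      then show ?thesis by (rule eventually_mono) simp
    qed
    then have ev: "\<forall>\<^sub>F n in sequentially. \<forall>i\<in>T. \<theta> * z i \<le> x n i + y n i"
      using T(1) by (simp add: eventually_ball_finite)
    have bound: "\<forall>\<^sub>F n in sequentially. \<theta> * pair z (R z) + (\<Sum>i\<in>T. (x n i + y n i - \<theta> * z i) * h i)
            \<le> pair (x n) (R x') + pair (y n) (R y')"
      using ev
    proof eventually_elim
      case (elim n)
      define \<rho> where "\<rho> = R (x n)"
      have "\<theta> * pair z (R z) + (\<Sum>i\<in>T. (x n i + y n i - \<theta> * z i) * h i)
          \<le> \<theta> * pair z \<rho> + (\<Sum>i\<in>T. (x n i + y n i - \<theta> * z i) * a i \<rho>)"
        using elim th by (intro add_mono mult_left_mono sum_mono le z h) auto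
      also have "\<dots> = pair (x n) \<rho> + pair (y n) \<rho>"
        by (simp add: pair_def sum_distrib_left flip: sum.distrib) (simp add: algebra_simps)
      also have "\<dots> \<le> pair (x n) (R x') + pair (y n) (R y')"
        using le[OF xn, of n "R x'"] le[OF yn, of n "R y'"] eq[of n] by (simp add: \<rho>_def)
      finally show ?case .
    qed
    have "\<theta> * pair z (R z) + (\<Sum>i\<in>T. (x' i + y' i - \<theta> * z i) * h i) \<le> pair x' (R x') + pair y' (R y')"
    proof (rule tendsto_le[OF _ _ _ bound])
      show "(\<lambda>n. pair (x n) (R x') + pair (y n) (R y')) \<longlonglongrightarrow> pair x' (R x') + pair y' (R y')"
        unfolding pair_def by (intro tendsto_intros limx limy)
      show "(\<lambda>n. \<theta> * pair z (R z) + (\<Sum>i\<in>T. (x n i + y n i - \<theta> * z i) * h i)) \<longlonglongrightarrow>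
          \<theta> * pair z (R z) + (\<Sum>i\<in>T. (x' i + y' i - \<theta> * z i) * h i)"
        by (intro tendsto_intros limx limy)
    qed simp
    moreover have "(\<Sum>i\<in>T. (x' i + y' i - \<theta> * z i) * h i) = (1 - \<theta>) * (\<Sum>i\<in>T. z i * h i)"
      by (simp add: sum_distrib_left z_def algebra_simps)
    ultimately show ?thesis by simp
  qed
  have "pair z (R z) \<le> pair x' (R x') + pair y' (R y')"
  proof (rule tendsto_upperbound)
    have "((\<lambda>\<theta>. \<theta> * pair z (R z) + (1 - \<theta>) * (\<Sum>i\<in>T. z i * h i)) \<longlongrightarrow>
        1 * pair z (R z) + (1 - 1) * (\<Sum>i\<in>T. z i * h i)) (at_left 1)"
      by (intro tendsto_intros)
    then show "((\<lambda>\<theta>. \<theta> * pair z (R z) + (1 - \<theta>) * (\<Sum>i\<in>T. z i * h i)) \<longlongrightarrow> pair z (R z)) (at_left 1)"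
      by simp
    have "\<forall>\<^sub>F \<theta> in at_left (1::real). \<theta> \<in> {0<..<1}"
      by (intro eventually_at_leftI[of 0]) auto
    then show "\<forall>\<^sub>F \<theta> in at_left 1. \<theta> * pair z (R z) + (1 - \<theta>) * (\<Sum>i\<in>T. z i * h i)
        \<le> pair x' (R x') + pair y' (R y')"
      by eventually_elim (use theta in auto)
  qed simp
  moreover have "pair z (R z) = pair x' (R z) + pair y' (R z)"
    by (simp add: pair_def z_def algebra_simps sum.distrib)
  \<comment> \<open>The minimum at \<open>z\<close> is at most the sum of the two minima, so the
    report \<open>R z\<close> attains both of them. Uniqueness then identifies it with
    \<open>R x'\<close> and with \<open>R y'\<close>.\<close>
  ultimately have "pair x' (R z) \<le> pair x' (R x')" "pair y' (R z) \<le> pair y' (R y')"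
    using le[OF x', of "R z"] le[OF y', of "R z"] by linarith+
  then show ?thesis using uniq[OF x'] uniq[OF y'] by metis
qed

text \<open>Take \<open>q\<close> of maximal rank. For a further \<open>g\<close>, weights near
  \<open>q\<close> that charge \<open>g\<close> admit a linear relation at their own reports.
  Nothing is known about how \<open>v\<close> depends on the report, so the relation is turned into
  an equality of \<open>R\<close> at two weights, and closedness carries that equality to the
  limit.\<close>

lemma exists_spanning_weight:
  assumes "I \<noteq> {}"
  obtains q J where "q \<in> weight_cone I" "J \<subseteq> supp q" "indexed_independent (\<lambda>i. v i (R q)) J"
    "\<And>g. g \<in> I \<Longrightarrow> \<exists>c. v g (R q) = (\<Sum>j\<in>J. c j *\<^sub>R v j (R q))"
proof -
  \<comment> \<open>\<open>good d\<close> says that rank at least \<open>d\<close> occurs on some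
    support. It holds for 0 and is bounded by the dimension, so a largest such \<open>d\<close>
    exists.\<close>
  define good where "good d \<longleftrightarrow> (\<exists>q J. q \<in> weight_cone I \<and> J \<subseteq> supp q \<and>
      indexed_independent (\<lambda>i. v i (R q)) J \<and> card J = d)" for d :: nat
  obtain i0 where i0: "i0 \<in> I" using assms by blast
  let ?e = "\<lambda>j. if j = i0 then 1 else (0::real)"
  have "supp ?e = {i0}" by (auto simp: supp_def)
  then have "?e \<in> weight_cone I" using i0 by (auto simp: weight_cone_def)
  then have "good 0"
    unfolding good_def by (intro exI[of _ ?e] exI[of _ "{}"]) (auto simp: indexed_independent_def)
  moreover have bound: "d \<le> DIM('e)" if "good d" for d
    using that unfolding good_def
    by (auto simp: weight_cone_def intro!: indexed_independent_card_le intro: finite_subset)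
  ultimately obtain d where d: "good d" "\<And>d'. good d' \<Longrightarrow> d' \<le> d"
    using ex_has_greatest_nat[of good 0 id "Suc DIM('e)"] by (auto simp: less_Suc_eq_le)
  then obtain q J where q: "q \<in> weight_cone I" and J: "J \<subseteq> supp q" "card J = d"
    and ind: "indexed_independent (\<lambda>i. v i (R q)) J"
    unfolding good_def by blast
  have fin: "finite (supp q)" "finite J" and qI: "supp q \<subseteq> I" and qnn: "\<And>i. 0 \<le> q i"
    using q J finite_subset by (auto simp: weight_cone_def)
  have "\<exists>c. v g (R q) = (\<Sum>j\<in>J. c j *\<^sub>R v j (R q))" if g: "g \<in> I" for g
  proof (cases "g \<in> J")
    case True
    have "v g (R q) = (\<Sum>j\<in>J. (if j = g then v j (R q) else 0))"
      using True fin by simp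
    also have "\<dots> = (\<Sum>j\<in>J. (if j = g then 1 else 0) *\<^sub>R v j (R q))"
      by (intro sum.cong) auto
    finally show ?thesis by (rule exI[of _ "\<lambda>j. if j = g then 1 else 0"])
  next
    case False
    define T where "T = insert g (supp q)"
    have T: "finite T" "T \<subseteq> I" using fin qI g by (auto simp: T_def)
    \<comment> \<open>The vanishing extra mass puts \<open>g\<close> into the support, so that
      maximality of \<open>d\<close> applies to \<open>insert g J\<close> at the report
      \<open>R (x n)\<close>.\<close>
    define x where "x n i = q i + (if i = g then 1 / real (Suc n) else 0)" for n i
    have x: "x n \<in> weight_cone I" "supp (x n) = T" for n
    proof -
      have "0 < x n g" using add_nonneg_pos[OF qnn[of g], of "1 / real (Suc n)"] by (simp add: x_def)
      moreover have "x n i = q i" if "i \<noteq> g" for i using that by (simp add: x_def)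
      ultimately show s: "supp (x n) = T"
        by (auto simp: supp_def T_def) (metis less_irrefl)+
      show "x n \<in> weight_cone I"
        using T qnn by (auto simp: weight_cone_def s) (auto simp: T_def x_def)
    qed
    define K where "K = insert g J"
    have K: "finite K" "K \<subseteq> T" using fin J by (auto simp: K_def T_def)
    have "\<exists>c. (\<Sum>j\<in>K. c j *\<^sub>R v j (R (x n))) = 0 \<and> (\<forall>j. j \<notin> K \<longrightarrow> c j = 0) \<and>
        (\<Sum>j\<in>K. \<bar>c j\<bar>) = 1 \<and> 0 \<le> c g" for n
    proof -
      have "\<not> indexed_independent (\<lambda>i. v i (R (x n))) K"
      proof
        assume "indexed_independent (\<lambda>i. v i (R (x n))) K"
        then have "good (card K)" using x K unfolding good_def by blast
        moreover have "card K = Suc d" using J fin False by (simp add: K_def)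
        ultimately show False using d(2) by fastforce
      qed
      then show ?thesis using K by (elim not_indexed_independentE[where g = g]) auto
    qed
    then obtain u where u: "\<And>n. (\<Sum>j\<in>K. u n j *\<^sub>R v j (R (x n))) = 0" "\<And>n j. j \<notin> K \<Longrightarrow> u n j = 0"
       "\<And>n. (\<Sum>j\<in>K. \<bar>u n j\<bar>) = 1" "\<And>n. 0 \<le> u n g"
      by metis
    have u1: "\<bar>u n i\<bar> \<le> 1" for n i
    proof (cases "i \<in> K")
      case True
      then have "\<bar>u n i\<bar> \<le> (\<Sum>j\<in>K. \<bar>u n j\<bar>)" using K by (intro member_le_sum) auto
      then show ?thesis using u(3) by simp
    qed (use u(2) in simp)
    obtain s l where s: "strict_mono (s :: nat \<Rightarrow> nat)"
      and l0: "\<And>i. i \<in> K \<Longrightarrow> (\<lambda>n. u (s n) i) \<longlonglongrightarrow> l i"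
      using convergent_subsequence_coordinates[of K u 1] K u1 by blast
    define l' where "l' i = (if i \<in> K then l i else 0)" for i
    have l: "(\<lambda>n. u (s n) i) \<longlonglongrightarrow> l' i" for i
      using l0 u(2) by (cases "i \<in> K") (auto simp: l'_def)
    have l'1: "\<bar>l' i\<bar> \<le> 1" for i
      using u1 by (intro tendsto_upperbound[OF tendsto_rabs[OF l]]) auto
    have l'g: "0 \<le> l' g"
      using u(4) by (intro tendsto_lowerbound[OF l]) auto
    have l'K: "(\<Sum>j\<in>K. \<bar>l' j\<bar>) = 1"
    proof (rule LIMSEQ_unique)
      show "(\<lambda>n. \<Sum>j\<in>K. \<bar>u (s n) j\<bar>) \<longlonglongrightarrow> (\<Sum>j\<in>K. \<bar>l' j\<bar>)"
        by (intro tendsto_intros l)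
      show "(\<lambda>n. \<Sum>j\<in>K. \<bar>u (s n) j\<bar>) \<longlonglongrightarrow> 1" by (simp add: u(3))
    qed
    \<comment> \<open>Half the smallest positive weight of \<open>q\<close>: a step
      \<open>\<delta>\<close> along coefficients of size at most 1 keeps the weights on
      \<open>supp q\<close> positive. At \<open>g\<close>, where \<open>q\<close> may vanish, the
      sign convention on the relations takes over.\<close>
    define \<delta> where "\<delta> = Min (q ` supp q) / 2"
    have qpos: "q i > 0" if "i \<in> supp q" for i using that qnn[of i] by (auto simp: supp_def)
    have ne: "supp q \<noteq> {}" using q by (auto simp: weight_cone_def)
    have \<delta>: "\<delta> > 0" using qpos fin ne by (simp add: \<delta>_def)
    have \<delta>q: "\<delta> < q i" if "i \<in> supp q" for i
    proof -
      have "2 * \<delta> \<le> q i" using that fin by (simp add: \<delta>_def)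
      then show ?thesis using \<delta> by linarith
    qed
    have in_cone: "w \<in> weight_cone I \<and> supp w \<subseteq> T"
      if w: "\<And>i. i \<notin> T \<Longrightarrow> w i = 0" "\<And>i. i \<in> supp q \<Longrightarrow> w i > 0" "w g \<ge> 0" for w
    proof -
      have sw: "supp w \<subseteq> T" "supp q \<subseteq> supp w"
        using w by (auto simp: supp_def T_def) (metis less_irrefl)
      have "w i \<ge> 0" for i
        using w(1)[of i] w(2)[of i] w(3) by (cases "i \<in> T") (auto simp: T_def less_imp_le)
      then show ?thesis
        using T sw ne finite_subset[OF sw(1)] by (auto simp: weight_cone_def)
    qed
    have \<delta>ge: "- \<delta> \<le> \<delta> * c" if "\<bar>c\<bar> \<le> 1" for c
      using that \<delta> mult_left_mono[of "-1" c \<delta>] by (auto simp: abs_le_iff)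
    \<comment> \<open>Moving \<open>x n\<close> along its own relation preserves the level equation
      at \<open>R (x n)\<close>, hence the value of \<open>R\<close>.\<close>
    define y where "y n i = x n i + \<delta> * u n i" for n i
    have "y n i > 0" if "i \<in> supp q" for n i
    proof -
      have "x n i \<ge> q i" by (simp add: x_def)
      then show ?thesis using \<delta>q[OF that] \<delta>ge[OF u1[of n i]] by (simp add: y_def)
    qed
    moreover have "y n i = 0" if "i \<notin> T" for n i
      using that u(2)[of i n] K by (auto simp: y_def x_def T_def supp_def)
    moreover have "y n g \<ge> 0" for n
      using qnn[of g] u(4)[of n] \<delta> by (simp add: y_def x_def)
    ultimately have y: "y n \<in> weight_cone I" "supp (y n) \<subseteq> T" for n
      using in_cone[of "y n"] by blast+
    define y' where "y' i = q i + \<delta> * l' i" for i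
    have "y' i > 0" if "i \<in> supp q" for i
      using \<delta>q[OF that] \<delta>ge[OF l'1[of i]] by (auto simp: y'_def)
    moreover have "y' i = 0" if "i \<notin> T" for i
      using that K by (auto simp: y'_def l'_def T_def supp_def)
    moreover have "y' g \<ge> 0"
      using qnn[of g] l'g \<delta> by (simp add: y'_def)
    ultimately have y': "y' \<in> weight_cone I" "supp y' \<subseteq> T"
      using in_cone[of y'] by blast+
    have Ky: "(\<Sum>j\<in>T. c j *\<^sub>R v j r) = (\<Sum>j\<in>K. c j *\<^sub>R v j r)" if "\<And>j. j \<notin> K \<Longrightarrow> c j = 0" for c r
      using K T that by (intro sum.mono_neutral_right) auto
    have lev: "(\<Sum>j\<in>T. w j *\<^sub>R v j r) = 0 \<longleftrightarrow> R w = r" if "w \<in> weight_cone I" "supp w \<subseteq> T" for w r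
      using level_set[OF that(1)] sum_supp_superset[OF T(1) that(2)] by metis
    have Ry: "R (x n) = R (y n)" for n
    proof -
      have "(\<Sum>j\<in>T. y n j *\<^sub>R v j (R (x n))) =
          (\<Sum>j\<in>T. x n j *\<^sub>R v j (R (x n))) + \<delta> *\<^sub>R (\<Sum>j\<in>T. u n j *\<^sub>R v j (R (x n)))"
        by (simp add: y_def scaleR_add_left sum.distrib scaleR_sum_right)
      also have "\<dots> = 0"
        using lev[OF x(1), of n] x(2) u(1) Ky[of "u n"] u(2) by simp
      finally show ?thesis using lev[OF y] by metis
    qed
    have "R q = R y'"
    proof (rule level_relation_closed[OF T, where x = "\<lambda>n. x (s n)" and y = "\<lambda>n. y (s n)"])
      have "(\<lambda>n. 1 / real (Suc n)) \<longlonglongrightarrow> 0"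
        using LIMSEQ_inverse_real_of_nat by (simp add: inverse_eq_divide)
      from LIMSEQ_subseq_LIMSEQ[OF this s] have "(\<lambda>n. 1 / real (Suc (s n))) \<longlonglongrightarrow> 0"
        by (simp add: o_def)
      then have *: "(\<lambda>n. if i = g then 1 / real (Suc (s n)) else 0) \<longlonglongrightarrow> 0" for i
        by (cases "i = g") simp_all
      have xs: "(\<lambda>n. x (s n) i) \<longlonglongrightarrow> q i" for i
        using tendsto_add[OF tendsto_const[of "q i"] *[of i]] by (simp add: x_def)
      then show "(\<lambda>n. x (s n) i) \<longlonglongrightarrow> q i" for i .
      show "(\<lambda>n. y (s n) i) \<longlonglongrightarrow> y' i" for i
        unfolding y_def y'_def by (intro tendsto_intros xs l)
    qed (use x y y' q Ry in \<open>auto simp: T_def\<close>)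
    then have "(\<Sum>j\<in>T. y' j *\<^sub>R v j (R q)) = 0" using lev[OF y'] by metis
    moreover have "(\<Sum>j\<in>T. q j *\<^sub>R v j (R q)) = 0" using lev[OF q] by (auto simp: T_def)
    moreover have "(\<Sum>j\<in>T. y' j *\<^sub>R v j (R q)) =
        (\<Sum>j\<in>T. q j *\<^sub>R v j (R q)) + \<delta> *\<^sub>R (\<Sum>j\<in>T. l' j *\<^sub>R v j (R q))"
      by (simp add: y'_def scaleR_add_left sum.distrib scaleR_sum_right)
    ultimately have "(\<Sum>j\<in>K. l' j *\<^sub>R v j (R q)) = 0"
      using \<delta> Ky[of l'] by (simp add: l'_def)
    then have rel: "l' g *\<^sub>R v g (R q) + (\<Sum>j\<in>J. l' j *\<^sub>R v j (R q)) = 0"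
      using False fin by (simp add: K_def)
    \<comment> \<open>Otherwise the limit relation would live on \<open>J\<close> alone and vanish
      by independence, against its unit l1 norm.\<close>
    have "l' g \<noteq> 0"
    proof
      assume 0: "l' g = 0"
      then have "\<forall>j\<in>J. l' j = 0" using rel ind unfolding indexed_independent_def by simp
      then show False using l'K 0 fin by (simp add: K_def False)
    qed
    have "v g (R q) = (1 / l' g) *\<^sub>R (l' g *\<^sub>R v g (R q))" using \<open>l' g \<noteq> 0\<close> by simp
    also have "l' g *\<^sub>R v g (R q) = - (\<Sum>j\<in>J. l' j *\<^sub>R v j (R q))"
      using rel by (simp add: eq_neg_iff_add_eq_0)
    also have "(1 / l' g) *\<^sub>R - (\<Sum>j\<in>J. l' j *\<^sub>R v j (R q)) = (\<Sum>j\<in>J. (- l' j / l' g) *\<^sub>R v j (R q))"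
      by (simp add: scaleR_sum_right sum_negf)
    finally show ?thesis by (intro exI[of _ "\<lambda>j. - l' j / l' g"])
  qed
  then show thesis using that q J ind by blast
qed

text \<open>The direction "unit mass at \<open>g\<close> minus \<open>c\<close> on \<open>J\<close>"
  is annihilated by the vectors \<open>v i (R q)\<close>, so the level equation survives. Negative
  entries of the direction can occur only on \<open>supp q\<close>, where a small step is
  harmless.\<close>

lemma level_perturbation:
  assumes q: "q \<in> weight_cone I" and J: "J \<subseteq> supp q" and g: "g \<in> I"
    and c: "v g (R q) = (\<Sum>j\<in>J. c j *\<^sub>R v j (R q))"
  obtains t w where "t > 0" "w \<in> weight_cone I" "R w = R q" "supp w \<subseteq> insert g (supp q)"
    "\<And>i. w i = q i + t * ((if i = g then 1 else 0) - (if i \<in> J then c i else 0))"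
proof -
  have fin: "finite (supp q)" "finite J" and qI: "supp q \<subseteq> I" and qnn: "\<And>i. 0 \<le> q i"
    and ne: "supp q \<noteq> {}"
    using q J finite_subset by (auto simp: weight_cone_def)
  have qpos: "q i > 0" if "i \<in> supp q" for i using that qnn[of i] by (auto simp: supp_def)
  define T where "T = insert g (supp q)"
  have T: "finite T" "T \<subseteq> I" using fin qI g by (auto simp: T_def)
  define d where "d i = (if i = g then 1 else 0) - (if i \<in> J then c i else 0)" for i
  define C where "C = (\<Sum>i\<in>T. \<bar>d i\<bar>) + 1"
  have C: "\<bar>d i\<bar> < C" if "i \<in> T" for i
  proof -
    have "\<bar>d i\<bar> \<le> (\<Sum>i\<in>T. \<bar>d i\<bar>)" using that T by (intro member_le_sum) auto
    then show ?thesis by (simp add: C_def)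
  qed
  have C0: "C > 0" unfolding C_def by (intro add_nonneg_pos sum_nonneg) auto
  \<comment> \<open>As \<open>C\<close> strictly exceeds every \<open>\<bar>d i\<bar>\<close>, the
    change on \<open>supp q\<close> stays strictly below the smallest weight of
    \<open>q\<close>.\<close>
  define t where "t = Min (q ` supp q) / C"
  have t: "t > 0" using qpos fin ne C0 by (simp add: t_def)
  have td: "\<bar>t * d i\<bar> < q i" if "i \<in> supp q" for i
  proof -
    have "\<bar>t * d i\<bar> = t * \<bar>d i\<bar>" using t by (simp add: abs_mult)
    also have "\<dots> < t * C" using t C[of i] that by (simp add: T_def)
    also have "\<dots> \<le> q i" using that fin C0 by (simp add: t_def)
    finally show ?thesis .
  qed
  define w where "w i = q i + t * d i" for i
  have wpos: "w i > 0" if "i \<in> supp q" for i using td[OF that] by (simp add: w_def abs_less_iff)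
  have w0: "w i = 0" if "i \<notin> T" for i
    using that J by (auto simp: w_def d_def T_def supp_def)
  have wg: "w g \<ge> 0"
  proof (cases "g \<in> supp q")
    case False
    then have "g \<notin> J" using J by auto
    then show ?thesis using qnn[of g] t by (simp add: w_def d_def)
  qed (use wpos in \<open>simp add: less_imp_le\<close>)
  have sw: "supp w \<subseteq> T" "supp q \<subseteq> supp w"
    using w0 wpos by (auto simp: supp_def) (metis less_irrefl)
  have wnn: "w i \<ge> 0" for i
    using wpos[of i] wg w0[of i] by (cases "i \<in> T") (auto simp: T_def less_imp_le)
  have w: "w \<in> weight_cone I"
    using T sw ne finite_subset[OF sw(1)] wnn by (auto simp: weight_cone_def)
  have "(\<Sum>i\<in>T. w i *\<^sub>R v i (R q)) = (\<Sum>i\<in>T. q i *\<^sub>R v i (R q)) + t *\<^sub>R (\<Sum>i\<in>T. d i *\<^sub>R v i (R q))"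
    by (simp add: w_def scaleR_add_left sum.distrib scaleR_sum_right)
  also have "(\<Sum>i\<in>T. q i *\<^sub>R v i (R q)) = 0"
    using level_set[OF q, of "R q"] sum_supp_superset[OF T(1), of q "\<lambda>i. v i (R q)"]
    by (simp add: T_def subset_insertI)
  also have "(\<Sum>i\<in>T. d i *\<^sub>R v i (R q)) =
      (\<Sum>i\<in>T. (if i = g then v i (R q) else 0)) - (\<Sum>i\<in>T. (if i \<in> J then c i *\<^sub>R v i (R q) else 0))"
    by (simp add: d_def scaleR_diff_left if_distrib[where f = "\<lambda>x. x *\<^sub>R _"] sum_subtractf cong: if_cong)
  also have "\<dots> = v g (R q) - (\<Sum>i\<in>J. c i *\<^sub>R v i (R q))"
  proof -
    have "T \<inter> J = J" using J by (auto simp: T_def)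
    then show ?thesis using T by (simp add: sum.If_cases) (simp add: T_def Int_def)
  qed
  finally have "(\<Sum>i\<in>T. w i *\<^sub>R v i (R q)) = 0" using c by simp
  then have "R w = R q" using level_set[OF w] sum_supp_superset[OF T(1) sw(1)] by metis
  then show thesis using that[OF t w] sw by (auto simp: w_def d_def T_def)
qed

end

section \<open>Gaussian mixtures and their modes\<close>

lemma measure_density_interval:
  fixes f :: "real \<Rightarrow> real"
  assumes cont: "continuous_on UNIV f" and nonneg: "\<And>x. 0 \<le> f x"
  shows "measure (density lborel (\<lambda>x. ennreal (f x))) {y - \<epsilon> .. y + \<epsilon>} = integral {-\<epsilon>..\<epsilon>} (\<lambda>s. f (y + s))"
proof -
  have [measurable]: "f \<in> borel_measurable borel"
    using cont by (rule borel_measurable_continuous_onI)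
  have int: "set_integrable lborel {y - \<epsilon> .. y + \<epsilon>} f"
    using cont continuous_on_subset by (intro borel_integrable_atLeastAtMost') blast
  have "emeasure (density lborel (\<lambda>x. ennreal (f x))) {y - \<epsilon> .. y + \<epsilon>} =
      (\<integral>\<^sup>+x. ennreal (indicator {y - \<epsilon> .. y + \<epsilon>} x *\<^sub>R f x) \<partial>lborel)"
    by (simp add: emeasure_density) (intro nn_integral_cong, simp add: indicator_def)
  also have "\<dots> = ennreal (LINT x:{y - \<epsilon> .. y + \<epsilon>}|lborel. f x)"
    unfolding set_lebesgue_integral_def
    using int by (intro nn_integral_eq_integral) (auto simp: set_integrable_def nonneg)
  also have "(LINT x:{y - \<epsilon> .. y + \<epsilon>}|lborel. f x) = integral {y - \<epsilon> .. y + \<epsilon>} f"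
    using int by (rule set_borel_integral_eq_integral)
  finally have "measure (density lborel (\<lambda>x. ennreal (f x))) {y - \<epsilon> .. y + \<epsilon>} =
      integral {y - \<epsilon> .. y + \<epsilon>} f"
    by (simp add: measure_def nonneg Henstock_Kurzweil_Integration.integral_nonneg
        integrable_continuous_real continuous_on_subset[OF cont])
  \<comment> \<open>Substitution moves the centre into the integrand, so windows at different
    centres can be compared pointwise in \<open>s\<close>.\<close>
  also have "\<dots> = integral {-\<epsilon>..\<epsilon>} (f \<circ> (\<lambda>s. s + y))"
    using continuous_on_subset[OF cont] integral_shift[of "-\<epsilon>" y \<epsilon> f] by (simp add: add.commute)
  finally show ?thesis by (simp add: o_def add.commute)
qed

text \<open>If \<open>f y\<close> exceeded \<open>f m\<close>, a short window at \<open>y\<close>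
  would carry more mass than every equally short window centred close to \<open>m\<close>, in
  particular more than the one at the modal midpoint.\<close>

lemma mode_is_maximizer:
  fixes f :: "real \<Rightarrow> real"
  assumes cont: "continuous_on UNIV f" and nonneg: "\<And>x. 0 \<le> f x"
    and mode: "is_mode (density lborel (\<lambda>x. ennreal (f x))) m"
  shows "f y \<le> f m"
proof (rule ccontr)
  assume "\<not> f y \<le> f m"
  then have lt: "f m < f y" by simp
  obtain eps xs where eps: "\<And>n. eps n > 0" "eps \<longlonglongrightarrow> 0" and xs: "xs \<longlonglongrightarrow> m"
    and mid: "\<And>n z. integral {-eps n..eps n} (\<lambda>s. f (z + s)) \<le> integral {-eps n..eps n} (\<lambda>s. f (xs n + s))"
    using mode unfolding is_mode_def modal_midpoint_def measure_density_interval[OF cont nonneg]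
    by blast
  \<comment> \<open>Two levels cutting the gap between \<open>f m\<close> and \<open>f y\<close>
    into thirds.\<close>
  define c1 c2 where "c1 = (2 * f y + f m) / 3" and "c2 = (f y + 2 * f m) / 3"
  have c: "f m < c2" "c2 < c1" "c1 < f y" using lt by (auto simp: c1_def c2_def)
  have isc: "isCont f x" for x using cont by (simp add: continuous_on_eq_continuous_at)
  then have lim: "(f \<longlongrightarrow> f x) (nhds x)" for x
    by (simp add: isCont_def tendsto_at_iff_tendsto_nhds)
  have "\<forall>\<^sub>F x in nhds y. c1 < f x" "\<forall>\<^sub>F x in nhds m. f x < c2"
    using order_tendstoD(1)[OF lim c(3)] order_tendstoD(2)[OF lim c(1)] .
  then obtain d1 d2 where d: "d1 > 0" "\<And>x. dist x y < d1 \<Longrightarrow> c1 < f x"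
      "d2 > 0" "\<And>x. dist x m < d2 \<Longrightarrow> f x < c2"
    unfolding eventually_nhds_metric by blast
  \<comment> \<open>Of the radius \<open>d2\<close>, one half pays for the distance of
    \<open>xs n\<close> from \<open>m\<close>, the other for the window itself.\<close>
  have "\<forall>\<^sub>F n in sequentially. eps n < min d1 (d2 / 2)"
    using d by (intro order_tendstoD(2)[OF eps(2)]) auto
  moreover have "\<forall>\<^sub>F n in sequentially. dist (xs n) m < d2 / 2"
    using d by (intro tendstoD[OF xs]) auto
  ultimately have "\<forall>\<^sub>F n in sequentially. eps n < min d1 (d2 / 2) \<and> dist (xs n) m < d2 / 2"
    by (rule eventually_conj)
  then obtain n where n: "eps n < d1" "eps n < d2 / 2" "dist (xs n) m < d2 / 2"
    by (auto simp: eventually_sequentially)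
  have int: "(\<lambda>s. f (z + s)) integrable_on {-eps n..eps n}" for z
    by (intro integrable_continuous_real continuous_on_compose2[OF cont] continuous_intros) auto
  have "2 * eps n * c1 \<le> integral {-eps n..eps n} (\<lambda>s. f (y + s))"
  proof -
    have "integral {-eps n..eps n} (\<lambda>s. c1) \<le> integral {-eps n..eps n} (\<lambda>s. f (y + s))"
    proof (intro integral_le int)
      fix s assume "s \<in> {- eps n..eps n}"
      then show "c1 \<le> f (y + s)"
        using n by (intro less_imp_le d(2)) (auto simp: dist_real_def)
    qed auto
    then show ?thesis using eps(1)[of n] by simp
  qed
  moreover have "integral {-eps n..eps n} (\<lambda>s. f (xs n + s)) \<le> 2 * eps n * c2"
  proof -
    have "integral {-eps n..eps n} (\<lambda>s. f (xs n + s)) \<le> integral {-eps n..eps n} (\<lambda>s. c2)"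
    proof (intro integral_le int)
      fix s assume "s \<in> {- eps n..eps n}"
      then have "\<bar>s\<bar> \<le> eps n" by (simp add: abs_le_iff)
      then have "dist (xs n + s) m < d2"
        using n abs_triangle_ineq[of "xs n - m" s] by (simp add: dist_real_def algebra_simps)
      then show "f (xs n + s) \<le> c2" by (intro less_imp_le d(4))
    qed auto
    then show ?thesis using eps(1)[of n] by simp
  qed
  ultimately have "2 * eps n * c1 \<le> 2 * eps n * c2" using mid[of n y] by linarith
  then show False using c eps(1)[of n] by simp
qed

text \<open>For existence, compactness gives the best centre within \<open>\<epsilon>\<close> of
  \<open>m\<close>. A window centred farther out lies on one monotone side and gains by moving
  towards \<open>m\<close>, so this centre is a global midpoint, and such centres converge to
  \<open>m\<close>. For uniqueness, every mode maximizes \<open>f\<close>.\<close>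

lemma unimodal_density:
  fixes f :: "real \<Rightarrow> real"
  assumes cont: "continuous_on UNIV f" and nonneg: "\<And>x. 0 \<le> f x"
    and incr: "\<And>x y. x < y \<Longrightarrow> y \<le> m \<Longrightarrow> f x < f y"
    and decr: "\<And>x y. m \<le> x \<Longrightarrow> x < y \<Longrightarrow> f y < f x"
  shows "unimodal (density lborel (\<lambda>x. ennreal (f x)))"
proof -
  let ?P = "density lborel (\<lambda>x. ennreal (f x))"
  have incr': "f x \<le> f y" if "x \<le> y" "y \<le> m" for x y
    using incr[of x y] that by (cases "x = y") auto
  have decr': "f y \<le> f x" if "m \<le> x" "x \<le> y" for x y
    using decr[of x y] that by (cases "x = y") auto
  have "\<exists>x. modal_midpoint ?P \<epsilon> x \<and> \<bar>x - m\<bar> \<le> \<epsilon>" if \<epsilon>: "\<epsilon> > 0" for \<epsilon>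
  proof -
    define h where "h y = integral {-\<epsilon>..\<epsilon>} (\<lambda>s. f (y + s))" for y
    have hm: "h y = measure ?P {y - \<epsilon> .. y + \<epsilon>}" for y
      by (simp add: h_def measure_density_interval[OF cont nonneg])
    have "continuous_on {m - \<epsilon>..m + \<epsilon>} (\<lambda>y. integral (cbox (-\<epsilon>) \<epsilon>) (\<lambda>s. f (y + s)))"
      by (rule integral_continuous_on_param, unfold split_beta)
        (intro continuous_on_compose2[OF cont] continuous_intros subset_UNIV)
    then have "continuous_on {m - \<epsilon>..m + \<epsilon>} h" unfolding h_def by simp
    moreover have "{m - \<epsilon>..m + \<epsilon>} \<noteq> {}" using \<epsilon> by simp
    ultimately obtain x where x: "x \<in> {m - \<epsilon>..m + \<epsilon>}" "\<And>y. y \<in> {m - \<epsilon>..m + \<epsilon>} \<Longrightarrow> h y \<le> h x"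
      using continuous_attains_sup[of "{m - \<epsilon>..m + \<epsilon>}" h] by auto
    have int: "(\<lambda>s. f (z + s)) integrable_on {-\<epsilon>..\<epsilon>}" for z
      by (intro integrable_continuous_real continuous_on_compose2[OF cont] continuous_intros) auto
    have "h y \<le> h x" for y
    proof -
      consider "y \<in> {m - \<epsilon>..m + \<epsilon>}" | "y < m - \<epsilon>" | "y > m + \<epsilon>" by fastforce
      then show ?thesis
      proof cases
        case 2
        then have "h y \<le> h (m - \<epsilon>)"
          unfolding h_def by (intro integral_le int incr') auto
        then show ?thesis using x(2)[of "m - \<epsilon>"] \<epsilon> by simp
      next
        case 3
        then have "h y \<le> h (m + \<epsilon>)"
          unfolding h_def by (intro integral_le int decr') auto
        then show ?thesis using x(2)[of "m + \<epsilon>"] \<epsilon> by simp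
      qed (use x in simp)
    qed
    then have "modal_midpoint ?P \<epsilon> x" by (simp add: modal_midpoint_def hm)
    then show ?thesis using x by (intro exI[of _ x]) (auto simp: abs_le_iff)
  qed
  then have "\<forall>n. \<exists>x. modal_midpoint ?P (1 / real (Suc n)) x \<and> \<bar>x - m\<bar> \<le> 1 / real (Suc n)"
    by simp
  then obtain xs where xs: "\<And>n. modal_midpoint ?P (1 / real (Suc n)) (xs n)"
      "\<And>n. \<bar>xs n - m\<bar> \<le> 1 / real (Suc n)"
    by metis
  have lim: "(\<lambda>n. 1 / real (Suc n)) \<longlonglongrightarrow> 0"
    using LIMSEQ_inverse_real_of_nat by (simp add: inverse_eq_divide)
  have "(\<lambda>n. xs n - m) \<longlonglongrightarrow> 0"
    by (rule tendsto_0_le[OF lim, of _ 1]) (use xs(2) in auto)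
  then have "xs \<longlonglongrightarrow> m" by (simp add: LIM_zero_iff)
  then have mode: "is_mode ?P m"
    using lim xs(1) unfolding is_mode_def
    by (intro exI[of _ "\<lambda>n. 1 / real (Suc n)"] exI[of _ xs]) auto
  have "m' = m" if "is_mode ?P m'" for m'
    using mode_is_maximizer[OF cont nonneg that, of m] incr[of m' m] decr[of m m']
    by (cases m' m rule: linorder_cases) auto
  then show ?thesis using mode unfolding unimodal_def by blast
qed

section \<open>Mixtures of unit-variance Gaussians, described by their weights\<close>

definition mixture :: "(real \<Rightarrow> real) \<Rightarrow> real \<Rightarrow> real" where
  "mixture w x = (\<Sum>\<mu>\<in>supp w. w \<mu> * normal_density \<mu> 1 x)"

definition total_weight :: "(real \<Rightarrow> real) \<Rightarrow> real" where
  "total_weight w = (\<Sum>\<mu>\<in>supp w. w \<mu>)"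

definition normalized_density :: "(real \<Rightarrow> real) \<Rightarrow> real \<Rightarrow> real" where
  "normalized_density w x = mixture w x / total_weight w"

definition mixture_measure :: "(real \<Rightarrow> real) \<Rightarrow> real measure" where
  "mixture_measure w = density lborel (\<lambda>x. ennreal (normalized_density w x))"

definition normal_density_deriv :: "real \<Rightarrow> real \<Rightarrow> real" where
  "normal_density_deriv \<mu> x = (\<mu> - x) * normal_density \<mu> 1 x"

lemma normal_density_1: "normal_density \<mu> 1 x = exp (- (x - \<mu>)\<^sup>2 / 2) / sqrt (2 * pi)"
  by (simp add: normal_density_def)

lemma has_derivative_normal_density:
  "(normal_density \<mu> 1 has_real_derivative normal_density_deriv \<mu> x) (at x)"
proof -
  have "((\<lambda>x. exp (- (x - \<mu>)\<^sup>2 / 2)) has_real_derivative (\<mu> - x) * exp (- (x - \<mu>)\<^sup>2 / 2)) (at x)"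
    by (auto intro!: derivative_eq_intros simp: field_simps)
  from DERIV_cdivide[OF this, of "sqrt (2 * pi)"] show ?thesis
    by (simp add: normal_density_1[abs_def] normal_density_deriv_def)
qed

lemma weight_coneD:
  assumes "w \<in> weight_cone I"
  shows "finite (supp w)" "supp w \<subseteq> I" "supp w \<noteq> {}" "\<mu> \<in> supp w \<Longrightarrow> 0 < w \<mu>" "total_weight w > 0"
proof -
  show 1: "finite (supp w)" "supp w \<subseteq> I" "supp w \<noteq> {}"
    using assms by (auto simp: weight_cone_def)
  show pos: "0 < w \<mu>" if "\<mu> \<in> supp w" for \<mu>
    using assms that by (auto simp: weight_cone_def supp_def order_less_le)
  show "total_weight w > 0" unfolding total_weight_def using 1 pos by (intro sum_pos) auto
qed

lemma has_derivative_normalized_density: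
  "(normalized_density w has_real_derivative (\<Sum>\<mu>\<in>supp w. w \<mu> * normal_density_deriv \<mu> x) / total_weight w) (at x)"
  unfolding normalized_density_def[abs_def] mixture_def
  by (auto intro!: derivative_eq_intros has_derivative_normal_density DERIV_cdivide sum.cong)

lemma continuous_on_normalized_density: "continuous_on UNIV (normalized_density w)"
  using DERIV_isCont[OF has_derivative_normalized_density]
  by (intro continuous_at_imp_continuous_on) auto

lemma normalized_density_nonneg: "w \<in> weight_cone I \<Longrightarrow> 0 \<le> normalized_density w x"
  unfolding normalized_density_def mixture_def
  by (intro divide_nonneg_nonneg sum_nonneg mult_nonneg_nonneg)
    (auto simp: weight_coneD less_imp_le dest: weight_coneD)

text \<open>A mode maximizes a differentiable density. For a fixed \<open>m\<close> the resulting
  condition is linear in \<open>w\<close>, which makes it comparable with the level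
  equations.\<close>

lemma critical_point_of_mode:
  assumes w: "w \<in> weight_cone I" and m: "is_mode (mixture_measure w) m"
  shows "(\<Sum>\<mu>\<in>supp w. w \<mu> * normal_density_deriv \<mu> m) = 0"
proof -
  have "(\<Sum>\<mu>\<in>supp w. w \<mu> * normal_density_deriv \<mu> m) / total_weight w = 0"
    using mode_is_maximizer[OF continuous_on_normalized_density normalized_density_nonneg[OF w]
        m[unfolded mixture_measure_def]]
    by (intro DERIV_local_max[OF has_derivative_normalized_density zero_less_one]) auto
  then show ?thesis using weight_coneD(5)[OF w] by simp
qed

text \<open>The second derivative carries the factor \<open>(t - \<mu>)\<^sup>2 - 1\<close>: the
  density is strictly concave within one standard deviation of its mean.\<close>

lemma normal_density_deriv_decreasing:
  assumes "x < y" "\<bar>x - \<mu>\<bar> < 1" "\<bar>y - \<mu>\<bar> < 1"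
  shows "normal_density_deriv \<mu> y < normal_density_deriv \<mu> x"
proof (rule DERIV_neg_imp_decreasing[OF assms(1)])
  fix t assume t: "x \<le> t" "t \<le> y"
  have "(normal_density_deriv \<mu> has_real_derivative ((t - \<mu>)\<^sup>2 - 1) * normal_density \<mu> 1 t) (at t)"
    unfolding normal_density_deriv_def[abs_def]
    by (auto intro!: derivative_eq_intros has_derivative_normal_density
        simp: normal_density_deriv_def power2_eq_square algebra_simps)
  moreover have "\<bar>t - \<mu>\<bar> < 1" using assms t by auto
  then have "(t - \<mu>)\<^sup>2 < 1" by (simp add: abs_square_less_1)
  then have "((t - \<mu>)\<^sup>2 - 1) * normal_density \<mu> 1 t < 0"
    by (intro mult_neg_pos normal_density_pos) auto
  ultimately show "\<exists>d. (normal_density_deriv \<mu> has_real_derivative d) (at t) \<and> d < 0" by blast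
qed

text \<open>All means lie in an open interval of length 1. To its left every component increases, to
  its right every component decreases, and on its closure every component is strictly concave. Hence
  the derivative of the mixture changes sign exactly once.\<close>

lemma mixture_unimodal:
  assumes w: "w \<in> weight_cone {c - 1/2<..<c + 1/2}"
  shows "unimodal (mixture_measure w)"
proof -
  note wD = weight_coneD[OF w]
  have near: "\<bar>\<mu> - c\<bar> < 1/2" if "\<mu> \<in> supp w" for \<mu>
  proof -
    have "c - 1/2 < \<mu>" "\<mu> < c + 1/2" using wD(2) that by auto
    then show ?thesis unfolding abs_less_iff by linarith
  qed
  define D where "D x = (\<Sum>\<mu>\<in>supp w. w \<mu> * normal_density_deriv \<mu> x) / total_weight w" for x
  have deriv: "(normalized_density w has_real_derivative D x) (at x)" for x
    unfolding D_def by (rule has_derivative_normalized_density)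
  have left: "0 < D x" if "x \<le> c - 1/2" for x
    unfolding D_def using that near wD
    by (intro divide_pos_pos sum_pos mult_pos_pos)
      (auto simp: normal_density_deriv_def abs_less_iff intro!: mult_pos_pos normal_density_pos
        dest!: near)
  have right: "D x < 0" if "c + 1/2 \<le> x" for x
  proof -
    have "0 < (\<Sum>\<mu>\<in>supp w. w \<mu> * - normal_density_deriv \<mu> x) / total_weight w"
      using that near wD
      by (intro divide_pos_pos sum_pos mult_pos_pos)
        (auto simp: normal_density_deriv_def abs_less_iff intro!: mult_neg_pos normal_density_pos
          dest!: near)
    then show ?thesis by (simp add: D_def sum_negf)
  qed
  have dec: "D y < D x" if "x < y" "c - 1/2 \<le> x" "y \<le> c + 1/2" for x y
    unfolding D_def
  proof (intro divide_strict_right_mono sum_strict_mono mult_strict_left_mono normal_density_deriv_decreasing)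
    fix \<mu> assume "\<mu> \<in> supp w"
    then show "\<bar>x - \<mu>\<bar> < 1" "\<bar>y - \<mu>\<bar> < 1" using near[of \<mu>] that unfolding abs_less_iff by linarith+
  qed (use that wD in auto)
  have "isCont D x" for x
    unfolding D_def normal_density_deriv_def normal_density_1
    by (intro continuous_intros) (use wD in auto)
  then obtain m where m: "c - 1/2 \<le> m" "m \<le> c + 1/2" "D m = 0"
    using IVT2[of D "c + 1/2" 0 "c - 1/2"] left[of "c - 1/2"] right[of "c + 1/2"] by fastforce
  have pos: "D x > 0" if "x < m" for x
    using left[of x] dec[of x m] m that by (cases "x \<le> c - 1/2") auto
  have neg: "D x < 0" if "m < x" for x
    using right[of x] dec[of m x] m that by (cases "c + 1/2 \<le> x") auto
  show ?thesis
    unfolding mixture_measure_def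
  proof (rule unimodal_density[where m = m])
    show "continuous_on UNIV (normalized_density w)" by (rule continuous_on_normalized_density)
    show "0 \<le> normalized_density w x" for x using w by (rule normalized_density_nonneg)
    show "normalized_density w x < normalized_density w y" if "x < y" "y \<le> m" for x y
      using that pos deriv
      by (intro DERIV_pos_imp_increasing_open[OF that(1)])
        (fastforce intro: continuous_on_subset[OF continuous_on_normalized_density])+
    show "normalized_density w y < normalized_density w x" if "m \<le> x" "x < y" for x y
      using that neg deriv
      by (intro DERIV_neg_imp_decreasing_open[OF that(2)])
        (fastforce intro: continuous_on_subset[OF continuous_on_normalized_density])+
  qed
qed

text \<open>Polynomial coefficients make the induction close: differentiation replaces
  \<open>p\<close> by \<open>p'\<close> plus \<open>p\<close> times
  \<open>\<mu> - x\<close>.\<close>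

lemma higher_deriv_polynomial_mixture_differentiable:
  assumes "finite S"
  shows "((deriv ^^ k) (\<lambda>x. \<Sum>\<mu>\<in>S. poly (p \<mu>) x * normal_density \<mu> 1 x)) differentiable (at x)"
proof (induction k arbitrary: p x)
  case 0
  have "(\<lambda>x. normal_density \<mu> 1 x) differentiable (at x)" for \<mu>
    using has_derivative_normal_density real_differentiable_def by blast
  moreover have "(\<lambda>x. poly (p \<mu>) x) differentiable (at x)" for \<mu>
    using poly_DERIV real_differentiable_def by blast
  ultimately show ?case using assms by (auto intro!: differentiable_sum differentiable_mult)
next
  case (Suc k)
  define p' where "p' \<mu> = pderiv (p \<mu>) + p \<mu> * [:\<mu>, -1:]" for \<mu>
  have "deriv (\<lambda>x. \<Sum>\<mu>\<in>S. poly (p \<mu>) x * normal_density \<mu> 1 x) =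
      (\<lambda>x. \<Sum>\<mu>\<in>S. poly (p' \<mu>) x * normal_density \<mu> 1 x)"
  proof
    fix x
    show "deriv (\<lambda>x. \<Sum>\<mu>\<in>S. poly (p \<mu>) x * normal_density \<mu> 1 x) x =
        (\<Sum>\<mu>\<in>S. poly (p' \<mu>) x * normal_density \<mu> 1 x)"
      by (rule DERIV_imp_deriv)
        (auto intro!: derivative_eq_intros has_derivative_normal_density sum.cong
          simp: p'_def normal_density_deriv_def algebra_simps)
  qed
  then show ?case using Suc.IH by (simp add: funpow_Suc_right del: funpow.simps)
qed

section \<open>Membership of the mixtures in \<open>class_Q\<close>\<close>

lemma normalized_density_smooth:
  assumes w: "w \<in> weight_cone I"
  shows "((deriv ^^ k) (normalized_density w)) differentiable (at x)"
proof -
  have eq: "normalized_density w = (\<lambda>x. \<Sum>\<mu>\<in>supp w. poly [:w \<mu> / total_weight w:] x * normal_density \<mu> 1 x)"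
    by (simp add: normalized_density_def[abs_def] mixture_def sum_divide_distrib)
  show ?thesis unfolding eq
    by (rule higher_deriv_polynomial_mixture_differentiable) (rule weight_coneD(1)[OF w])
qed

lemma normalized_density_bounded:
  assumes w: "w \<in> weight_cone I"
  shows "bounded (range (normalized_density w))"
proof -
  have "normalized_density w x \<le> (\<Sum>\<mu>\<in>supp w. w \<mu> * (1 / sqrt (2 * pi))) / total_weight w" for x
    unfolding normalized_density_def mixture_def
    using weight_coneD[OF w]
    by (intro divide_right_mono sum_mono mult_left_mono)
      (auto simp: normal_density_1 divide_right_mono less_imp_le)
  then show ?thesis
    using normalized_density_nonneg[OF w] by (intro boundedI) auto
qed

lemma normalized_density_gaussian_mixture:
  assumes w: "w \<in> weight_cone I"
  shows "gaussian_mixture (normalized_density w)"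
proof -
  note wD = weight_coneD[OF w]
  obtain e where e: "bij_betw e {..<card (supp w)} (supp w)"
    using ex_bij_betw_nat_finite[OF wD(1)] by (auto simp: lessThan_atLeast0)
  have "card (supp w) \<ge> 1" using wD by (simp add: Suc_le_eq card_gt_0_iff)
  moreover have "0 < w (e i) / total_weight w" if "i < card (supp w)" for i
    using wD bij_betwE[OF e] that by auto
  moreover have "(\<Sum>i<card (supp w). w (e i) / total_weight w) = 1"
    using sum.reindex_bij_betw[OF e, of "\<lambda>\<mu>. w \<mu> / total_weight w"] wD(5)
    by (simp add: total_weight_def flip: sum_divide_distrib)
  moreover have "normalized_density w x =
      (\<Sum>i<card (supp w). w (e i) / total_weight w * normal_density (e i) 1 x)" for x
    using sum.reindex_bij_betw[OF e, of "\<lambda>\<mu>. w \<mu> / total_weight w * normal_density \<mu> 1 x"]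
    by (simp add: normalized_density_def mixture_def sum_divide_distrib)
  ultimately show ?thesis
    unfolding gaussian_mixture_def
    by (intro exI[of _ "card (supp w)"] exI[of _ "\<lambda>i. w (e i) / total_weight w"] exI[of _ e]
        exI[of _ "\<lambda>_. 1"]) auto
qed

lemma mixture_measure_prob_space:
  assumes w: "w \<in> weight_cone I"
  shows "prob_space (mixture_measure w)"
proof
  have "integrable lborel (normalized_density w)"
    unfolding normalized_density_def[abs_def] mixture_def by auto
  moreover have "(\<integral>x. normalized_density w x \<partial>lborel) = 1"
    using weight_coneD(5)[OF w] unfolding normalized_density_def[abs_def] mixture_def
    by (simp add: total_weight_def)
  moreover have "normalized_density w \<in> borel_measurable borel"
    using continuous_on_normalized_density by (rule borel_measurable_continuous_onI)
  ultimately show "emeasure (mixture_measure w) (space (mixture_measure w)) = 1"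
    by (simp add: mixture_measure_def emeasure_density nn_integral_eq_integral
        normalized_density_nonneg[OF w])
qed

lemma mixture_measure_in_class_Q:
  assumes w: "w \<in> weight_cone {c - 1/2<..<c + 1/2}"
  shows "mixture_measure w \<in> class_Q"
  unfolding class_Q_def class_P_def
  using mixture_measure_prob_space[OF w] mixture_unimodal[OF w] normalized_density_nonneg[OF w]
    normalized_density_bounded[OF w] normalized_density_smooth[OF w]
    normalized_density_gaussian_mixture[OF w]
  by (auto simp: mixture_measure_def)

definition gaussian :: "real \<Rightarrow> real measure" where
  "gaussian \<mu> = density lborel (\<lambda>x. ennreal (normal_density \<mu> 1 x))"

text \<open>A unit weight, on the interval centred at its own mean. Since every real mean is
  covered, loss and identification functions are integrable under all Gaussians of unit variance, as
  the Laplace transform argument requires.\<close>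

lemma gaussian_in_class_Q: "gaussian \<mu> \<in> class_Q"
proof -
  define w where "w i = (if i = \<mu> then 1 else 0 :: real)" for i
  have s: "supp w = {\<mu>}" by (auto simp: supp_def w_def)
  then have "w \<in> weight_cone {\<mu> - 1/2<..<\<mu> + 1/2}" by (auto simp: weight_cone_def w_def)
  moreover have "mixture_measure w = gaussian \<mu>"
    by (simp add: mixture_measure_def gaussian_def normalized_density_def mixture_def total_weight_def s w_def)
  ultimately show ?thesis using mixture_measure_in_class_Q by metis
qed

lemma integral_mixture_measure:
  fixes h :: "real \<Rightarrow> 'b::{banach, second_countable_topology}"
  assumes w: "w \<in> weight_cone I" and int: "\<And>\<mu>. \<mu> \<in> supp w \<Longrightarrow> integrable (gaussian \<mu>) h"
  shows "(\<integral>y. h y \<partial>mixture_measure w) = (1 / total_weight w) *\<^sub>R (\<Sum>\<mu>\<in>supp w. w \<mu> *\<^sub>R (\<integral>y. h y \<partial>gaussian \<mu>))"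
proof -
  obtain \<mu>0 where "\<mu>0 \<in> supp w" using weight_coneD(3)[OF w] by blast
  then have h[measurable]: "h \<in> borel_measurable borel"
    using int borel_measurable_integrable by (fastforce simp: gaussian_def)
  have [measurable]: "normalized_density w \<in> borel_measurable borel"
    using continuous_on_normalized_density by (rule borel_measurable_continuous_onI)
  have int': "integrable lborel (\<lambda>y. normal_density \<mu> 1 y *\<^sub>R h y)" if "\<mu> \<in> supp w" for \<mu>
    using int[OF that] by (simp add: gaussian_def integrable_density)
  have "(\<integral>y. h y \<partial>mixture_measure w) = (\<integral>y. normalized_density w y *\<^sub>R h y \<partial>lborel)"
    unfolding mixture_measure_def
    by (intro integral_density) (auto simp: normalized_density_nonneg[OF w])
  also have "\<dots> = (\<integral>y. (1 / total_weight w) *\<^sub>R (\<Sum>\<mu>\<in>supp w. w \<mu> *\<^sub>R normal_density \<mu> 1 y *\<^sub>R h y) \<partial>lborel)"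
    
    by (simp add: normalized_density_def mixture_def sum_divide_distrib scaleR_sum_left scaleR_sum_right)
  also have "\<dots> = (1 / total_weight w) *\<^sub>R (\<Sum>\<mu>\<in>supp w. w \<mu> *\<^sub>R (\<integral>y. normal_density \<mu> 1 y *\<^sub>R h y \<partial>lborel))"
    using int' by (simp add: Bochner_Integration.integral_sum del: scaleR_scaleR)
  also have "\<dots> = (1 / total_weight w) *\<^sub>R (\<Sum>\<mu>\<in>supp w. w \<mu> *\<^sub>R (\<integral>y. h y \<partial>gaussian \<mu>))"
    by (simp add: gaussian_def integral_density)
  finally show ?thesis .
qed

section \<open>Laplace transforms\<close>

text \<open>Once the lower coefficients vanish, divide by \<open>x ^ k\<close> and let
  \<open>x\<close> tend to 0.\<close>

lemma powser_sums_0_coeff_zero: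
  fixes b :: "nat \<Rightarrow> real"
  assumes r: "r > 0" and sums: "\<And>x. \<bar>x\<bar> < r \<Longrightarrow> (\<lambda>n. b n * x ^ n) sums 0"
  shows "b k = 0"
proof (induction k rule: less_induct)
  case (less k)
  have "(\<lambda>n. b (n + k) * x ^ n) sums 0" if "x \<noteq> 0" "norm x < r" for x
  proof -
    have "(\<lambda>n. b (n + k) * x ^ (n + k)) sums (0 - (\<Sum>n<k. b n * x ^ n))"
      using sums[of x] that by (intro sums_split_initial_segment) auto
    then have "(\<lambda>n. b (n + k) * x ^ (n + k)) sums 0" using less by simp
    from sums_mult[OF this, of "1 / x ^ k"] show ?thesis
      using that by (simp add: power_add field_simps)
  qed
  from powser_limit_0_strong[OF r this] have "((\<lambda>_. 0) \<longlongrightarrow> b (0 + k)) (at (0::real))"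
    by simp
  then show ?case by (simp add: tendsto_const_iff)
qed

text \<open>The transform about \<open>m\<close> is entire, with the moments over factorials as
  Taylor coefficients: integrate the exponential series termwise by dominated convergence.\<close>

lemma laplace_transform_sums:
  fixes F :: "real \<Rightarrow> real" and z :: complex
  assumes int: "\<And>t. integrable lborel (\<lambda>y. F y * exp (t * y))"
  shows "(\<lambda>j. of_real ((\<integral>y. F y * (y - m) ^ j \<partial>lborel) / fact j) * z ^ j) sums
      (\<integral>y. of_real (F y) * exp (z * of_real (y - m)) \<partial>lborel)"
proof -
  have intm: "integrable lborel (\<lambda>y. F y * exp (t * (y - m)))" for t
    using integrable_mult_left[OF int[of t], of "exp (- t * m)"]
    by (simp add: algebra_simps exp_diff exp_minus field_simps)
  have [measurable]: "F \<in> borel_measurable borel"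
    using int[of 0] by (auto dest: borel_measurable_integrable)
  \<comment> \<open>An integrable majorant of
    \<open>\<bar>F y\<bar> * exp (c * \<bar>y - m\<bar>)\<close>, obtained by adding the integrands
    for both signs of the exponent.\<close>
  define W where "W c y = norm (F y * exp (c * (y - m))) + norm (F y * exp (- c * (y - m)))" for c y
  have W: "integrable lborel (W c)" for c
    unfolding W_def by (intro Bochner_Integration.integrable_add integrable_norm intm)
  have expabs: "exp (c * \<bar>x\<bar>) \<le> exp (c * x) + exp (- c * x)" for c x :: real
    by (cases "x \<ge> 0") auto
  have absW: "\<bar>F y\<bar> * exp (c * \<bar>y - m\<bar>) \<le> W c y" for c y
    using mult_left_mono[OF expabs[of c "y - m"], of "\<bar>F y\<bar>"]
    by (simp add: W_def abs_mult algebra_simps)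
  have pw: "integrable lborel (\<lambda>y. F y * (y - m) ^ j)" for j
  proof (rule Bochner_Integration.integrable_bound)
    show "integrable lborel (\<lambda>y. fact j * W 1 y)" using W by simp
    show "AE y in lborel. norm (F y * (y - m) ^ j) \<le> norm (fact j * W 1 y)"
    proof (intro AE_I2)
      fix y
      have "\<bar>y - m\<bar> ^ j / fact j \<le> exp \<bar>y - m\<bar>"
      proof -
        have "(\<lambda>n. \<bar>y - m\<bar> ^ n / fact n) sums exp \<bar>y - m\<bar>"
          using exp_converges[of "\<bar>y - m\<bar>"] by (simp add: divide_inverse mult.commute)
        from sum_le_suminf[OF sums_summable[OF this], of "{j}"] sums_unique[OF this] show ?thesis
          by simp
      qed
      then have "\<bar>F y\<bar> * \<bar>y - m\<bar> ^ j \<le> \<bar>F y\<bar> * (fact j * exp (1 * \<bar>y - m\<bar>))"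
        by (intro mult_left_mono) (auto simp: field_simps)
      also have "\<dots> \<le> fact j * W 1 y"
        using mult_left_mono[OF absW[of y 1], of "fact j"] by (simp add: algebra_simps)
      finally show "norm (F y * (y - m) ^ j) \<le> norm (fact j * W 1 y)"
        by (simp add: abs_mult power_abs W_def)
    qed
  qed measurable
  define s where "s n y = (\<Sum>j<n. complex_of_real (F y * (y - m) ^ j) * (z ^ j / fact j))" for n y
  have "(\<lambda>n. \<integral>y. s n y \<partial>lborel) \<longlonglongrightarrow> (\<integral>y. of_real (F y) * exp (z * of_real (y - m)) \<partial>lborel)"
  proof (rule integral_dominated_convergence)
    show "AE y in lborel. (\<lambda>n. s n y) \<longlonglongrightarrow> of_real (F y) * exp (z * of_real (y - m))"
    proof (intro AE_I2)
      fix y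
      have "(\<lambda>n. (z * of_real (y - m)) ^ n /\<^sub>R fact n) sums exp (z * of_real (y - m))"
        by (rule exp_converges)
      from sums_mult[OF this, of "of_real (F y)"]
      have "(\<lambda>n. complex_of_real (F y * (y - m) ^ n) * (z ^ n / fact n)) sums
          (of_real (F y) * exp (z * of_real (y - m)))"
        by (simp add: scaleR_conv_of_real power_mult_distrib divide_inverse mult_ac del: of_real_diff)
      then show "(\<lambda>n. s n y) \<longlonglongrightarrow> of_real (F y) * exp (z * of_real (y - m))"
        unfolding sums_def s_def .
    qed
    show "AE y in lborel. norm (s n y) \<le> W (norm z) y" for n
    proof (intro AE_I2)
      fix y
      have "norm (s n y) \<le> (\<Sum>j<n. norm (complex_of_real (F y * (y - m) ^ j) * (z ^ j / fact j)))"
        unfolding s_def by (rule norm_sum)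
      also have "\<dots> = \<bar>F y\<bar> * (\<Sum>j<n. (norm z * \<bar>y - m\<bar>) ^ j / fact j)"
        by (simp add: norm_mult norm_divide norm_power abs_mult power_abs sum_distrib_left
            power_mult_distrib algebra_simps del: of_real_mult of_real_power of_real_diff)
      also have "\<dots> \<le> \<bar>F y\<bar> * exp (norm z * \<bar>y - m\<bar>)"
      proof (intro mult_left_mono)
        have "(\<lambda>n. (norm z * \<bar>y - m\<bar>) ^ n / fact n) sums exp (norm z * \<bar>y - m\<bar>)"
          using exp_converges[of "norm z * \<bar>y - m\<bar>"] by (simp add: divide_inverse mult.commute)
        from sum_le_suminf[OF sums_summable[OF this], of "{..<n}"] sums_unique[OF this]
        show "(\<Sum>j<n. (norm z * \<bar>y - m\<bar>) ^ j / fact j) \<le> exp (norm z * \<bar>y - m\<bar>)"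
          by simp
      qed auto
      also have "\<dots> \<le> W (norm z) y" by (rule absW)
      finally show "norm (s n y) \<le> W (norm z) y" .
    qed
    show "integrable lborel (W (norm z))" by (rule W)
    show "s n \<in> borel_measurable lborel" for n unfolding s_def by measurable
  qed measurable
  moreover have "(\<integral>y. s n y \<partial>lborel) =
      (\<Sum>j<n. of_real ((\<integral>y. F y * (y - m) ^ j \<partial>lborel) / fact j) * z ^ j)" for n
  proof -
    have pwc: "integrable lborel (\<lambda>y. complex_of_real (F y * (y - m) ^ j) * (z ^ j / fact j))" for j
      by (intro integrable_mult_left integrable_of_real pw)
    have "(\<integral>y. s n y \<partial>lborel) =
        (\<Sum>j<n. \<integral>y. complex_of_real (F y * (y - m) ^ j) * (z ^ j / fact j) \<partial>lborel)"
      unfolding s_def by (intro Bochner_Integration.integral_sum pwc)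
    also have "\<dots> = (\<Sum>j<n. complex_of_real (\<integral>y. F y * (y - m) ^ j \<partial>lborel) * (z ^ j / fact j))"
      by (simp del: of_real_mult of_real_power of_real_diff)
    finally show ?thesis by simp
  qed
  ultimately show ?thesis by (simp add: sums_def)
qed

text \<open>Being affine on a real interval fixes all Taylor coefficients, so the transform equals
  \<open>A + z * C\<close> on the whole plane. On the imaginary axis it is bounded by the integral
  of \<open>\<bar>F\<bar>\<close>, which forces the slope to vanish.\<close>

lemma laplace_transform_not_affine:
  fixes F :: "real \<Rightarrow> real"
  assumes int: "\<And>t. integrable lborel (\<lambda>y. F y * exp (t * y))"
    and r: "r > 0"
    and affine: "\<And>t. \<bar>t\<bar> < r \<Longrightarrow> (\<integral>y. F y * exp (t * (y - m)) \<partial>lborel) = A + t * C"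
  shows "C = 0"
proof (rule ccontr)
  assume C: "C \<noteq> 0"
  define M where "M j = (\<integral>y. F y * (y - m) ^ j \<partial>lborel) / fact j" for j
  note sums = laplace_transform_sums[where F = F and m = m, OF int, folded M_def]
  define p where "p j = (if j = 0 then A else if j = 1 then C else 0)" for j :: nat
  have M: "M k = p k" for k
  proof -
    have "(\<lambda>j. (M j - p j) * t ^ j) sums 0" if t: "\<bar>t\<bar> < r" for t
    proof -
      have "(\<integral>y. complex_of_real (F y) * exp (of_real t * of_real (y - m)) \<partial>lborel) =
          (\<integral>y. complex_of_real (F y * exp (t * (y - m))) \<partial>lborel)"
        by (intro Bochner_Integration.integral_cong) (simp_all add: exp_of_real flip: of_real_mult of_real_diff)
      also have "\<dots> = of_real (A + t * C)"
        unfolding integral_complex_of_real affine[OF t] ..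
      finally have "(\<lambda>j. complex_of_real (M j * t ^ j)) sums of_real (A + t * C)"
        using sums[of "of_real t"] by simp
      then have 1: "(\<lambda>j. M j * t ^ j) sums (A + t * C)"
        unfolding sums_of_real_iff .
      have "(\<lambda>j. p j * t ^ j) sums (\<Sum>j\<in>{0,1}. p j * t ^ j)"
        by (rule sums_finite) (auto simp: p_def)
      then have 2: "(\<lambda>j. p j * t ^ j) sums (A + t * C)"
        by (simp add: p_def mult.commute)
      show ?thesis using sums_diff[OF 1 2] by (simp add: algebra_simps)
    qed
    from powser_sums_0_coeff_zero[OF r this] have "M k - p k = 0" by simp
    then show ?thesis by simp
  qed
  define B where "B = (\<integral>y. \<bar>F y\<bar> \<partial>lborel)"
  have intF: "integrable lborel F" using int[of 0] by simp
  have bound: "\<bar>x * C\<bar> \<le> B + \<bar>A\<bar>" for x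
  proof -
    let ?I = "\<integral>y. complex_of_real (F y) * exp (\<i> * of_real x * of_real (y - m)) \<partial>lborel"
    have 1: "(\<lambda>j. complex_of_real (p j) * (\<i> * of_real x) ^ j) sums
        (\<Sum>j\<in>{0,1}. complex_of_real (p j) * (\<i> * of_real x) ^ j)"
      by (rule sums_finite) (auto simp: p_def)
    have 2: "(\<lambda>j. complex_of_real (p j) * (\<i> * of_real x) ^ j) sums ?I"
      using sums[of "\<i> * of_real x"] by (simp add: M)
    have I: "?I = of_real A + \<i> * of_real (x * C)"
      unfolding sums_unique2[OF 2 1] by (simp add: p_def mult.commute)
    have "norm ?I \<le> (\<integral>y. norm (complex_of_real (F y) * exp (\<i> * of_real x * of_real (y - m))) \<partial>lborel)"
      by (rule integral_norm_bound)
    also have "\<dots> = B"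
    proof -
      have "norm (exp (\<i> * complex_of_real x * of_real (y - m))) = 1" for y
        by (simp add: norm_exp_eq_Re)
      then show ?thesis unfolding B_def
        by (intro Bochner_Integration.integral_cong) (simp_all add: norm_mult)
    qed
    finally have "norm ?I \<le> B" .
    moreover have "\<bar>x * C\<bar> = \<bar>Im ?I\<bar>" unfolding I by simp
    ultimately show ?thesis using abs_Im_le_cmod[of ?I] by linarith
  qed
  have "B + \<bar>A\<bar> + 1 \<le> B + \<bar>A\<bar>"
  proof -
    have "B \<ge> 0" by (simp add: B_def)
    then show ?thesis using bound[of "(B + \<bar>A\<bar> + 1) / C"] C by simp
  qed
  then show False by simp
qed

section \<open>Infinite complexity of the mode\<close>

text \<open>Assume equality near 0 and weight \<open>u\<close> by the standard normal density. Its
  Laplace transform about \<open>m\<close> would be \<open>(t - m) * normal_density 0 1 m\<close>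
  for small \<open>t\<close>: affine, with a positive slope.\<close>

lemma normal_density_deriv_not_integral:
  fixes u :: "real \<Rightarrow> real"
  assumes int: "\<And>\<mu>. integrable (gaussian \<mu>) u" and r: "r > 0"
  shows "\<exists>\<mu>. \<bar>\<mu>\<bar> < r \<and> (\<integral>y. u y \<partial>gaussian \<mu>) \<noteq> normal_density_deriv \<mu> m"
proof (rule ccontr)
  assume "\<not> ?thesis"
  then have u: "(\<integral>y. u y \<partial>gaussian \<mu>) = normal_density_deriv \<mu> m" if "\<bar>\<mu>\<bar> < r" for \<mu>
    using that by blast
  define F where "F y = u y * normal_density 0 1 y" for y
  \<comment> \<open>Exponential tilting of the standard Gaussian shifts its mean to
    \<open>t\<close>, up to a constant factor.\<close>
  have shift: "normal_density 0 1 y * exp (t * y) = exp (t\<^sup>2 / 2) * normal_density t 1 y" for t y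
    unfolding normal_density_1
    by (simp add: exp_add[symmetric] exp_diff[symmetric] field_simps power2_eq_square
        flip: exp_add exp_diff exp_minus)
  have F: "F y * exp (t * y) = exp (t\<^sup>2 / 2) * (normal_density t 1 y * u y)" for t y
    using shift[of y t] by (simp add: F_def algebra_simps)
  have [measurable]: "u \<in> borel_measurable borel"
    using borel_measurable_integrable[OF int[of 0]] by (simp add: gaussian_def)
  have int': "integrable lborel (\<lambda>y. normal_density t 1 y * u y)" for t
    using int[of t] by (simp add: gaussian_def integrable_real_density)
  have "normal_density 0 1 m = 0"
  proof (rule laplace_transform_not_affine[OF _ r])
    show "integrable lborel (\<lambda>y. F y * exp (t * y))" for t
      unfolding F by (intro integrable_mult_right int')
    fix t :: real assume t: "\<bar>t\<bar> < r"
    have "(\<integral>y. F y * exp (t * (y - m)) \<partial>lborel) = (\<integral>y. exp (- t * m) * (F y * exp (t * y)) \<partial>lborel)"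
      by (intro Bochner_Integration.integral_cong) (simp_all add: algebra_simps flip: exp_add)
    also have "\<dots> = exp (- t * m) * (exp (t\<^sup>2 / 2) * (\<integral>y. u y \<partial>gaussian t))"
      unfolding F by (simp add: gaussian_def integral_real_density)
    also have "\<dots> = (t - m) * (exp (- t * m) * (exp (t\<^sup>2 / 2) * normal_density t 1 m))"
      by (simp add: u[OF t] normal_density_deriv_def)
    also have "\<dots> = (t - m) * normal_density 0 1 m"
      by (simp add: flip: shift) (simp add: exp_minus)
    finally show "(\<integral>y. F y * exp (t * (y - m)) \<partial>lborel) = - m * normal_density 0 1 m + t * normal_density 0 1 m"
      by (simp add: algebra_simps)
  qed
  then show False using normal_density_pos[of 1 0 m] by simp
qed

theorem theorem2:
  fixes Ghat :: "real measure \<Rightarrow> real ^ 'k"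
  shows "\<not> (elicitable class_Q Ghat \<and> identifiable class_Q Ghat \<and>
            (\<exists>f :: real ^ 'k \<Rightarrow> real. \<forall>P\<in>class_Q. mode P = f (Ghat P)))"
proof
  assume *: "elicitable class_Q Ghat \<and> identifiable class_Q Ghat \<and>
            (\<exists>f :: real ^ 'k \<Rightarrow> real. \<forall>P\<in>class_Q. mode P = f (Ghat P))"
  then have "elicitable class_Q Ghat" by blast
  then obtain L :: "real ^ 'k \<Rightarrow> real \<Rightarrow> real"
    where L0: "\<forall>P\<in>class_Q. \<forall>r. integrable P (L r)"
      "\<forall>P\<in>class_Q. {Ghat P} = {r. \<forall>r'. (\<integral>y. L r y \<partial>P) \<le> (\<integral>y. L r' y \<partial>P)}"
    unfolding elicitable_def by (elim exE conjE) (rule that)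
  note L = L0(1)[THEN bspec, THEN spec] L0(2)[THEN bspec]
  have "identifiable class_Q Ghat" using * by blast
  then obtain V :: "real ^ 'k \<Rightarrow> real \<Rightarrow> real ^ 'k"
    where V0: "\<forall>P\<in>class_Q. \<forall>r. integrable P (V r)"
      "\<forall>P\<in>class_Q. \<forall>r. Ghat P = r \<longleftrightarrow> (\<integral>y. V r y \<partial>P) = 0"
    unfolding identifiable_def by (elim exE conjE) (rule that)
  note V = V0(1)[THEN bspec, THEN spec] V0(2)[THEN bspec, THEN spec]
  obtain f where f: "\<And>P. P \<in> class_Q \<Longrightarrow> mode P = f (Ghat P)" using * by blast
  define I where "I = {0 - 1/2<..<0 + 1/2 :: real}"
  define a where "a \<mu> r = (\<integral>y. L r y \<partial>gaussian \<mu>)" for \<mu> r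
  define v where "v \<mu> r = (\<integral>y. V r y \<partial>gaussian \<mu>)" for \<mu> r
  define R where "R w = Ghat (mixture_measure w)" for w
  have Q: "mixture_measure w \<in> class_Q" if "w \<in> weight_cone I" for w
    using that unfolding I_def by (rule mixture_measure_in_class_Q)
  have intL: "(\<integral>y. L r y \<partial>mixture_measure w) = (1 / total_weight w) *\<^sub>R (\<Sum>\<mu>\<in>supp w. w \<mu> *\<^sub>R a \<mu> r)"
    if "w \<in> weight_cone I" for w r
    unfolding a_def by (rule integral_mixture_measure[OF that]) (rule L gaussian_in_class_Q)+
  have intV: "(\<integral>y. V r y \<partial>mixture_measure w) = (1 / total_weight w) *\<^sub>R (\<Sum>\<mu>\<in>supp w. w \<mu> *\<^sub>R v \<mu> r)"
    if "w \<in> weight_cone I" for w r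
    unfolding v_def by (rule integral_mixture_measure[OF that]) (rule V gaussian_in_class_Q)+
  \<comment> \<open>Expectations under a mixture are averages over its components. The positive
    factor \<open>1 / total_weight w\<close> affects neither the minimizers nor the zeros.\<close>
  interpret cone_property I a v R
  proof
    fix w r assume w: "w \<in> weight_cone I"
    have le: "(\<integral>y. L r y \<partial>mixture_measure w) \<le> (\<integral>y. L r' y \<partial>mixture_measure w) \<longleftrightarrow>
        (\<Sum>\<mu>\<in>supp w. w \<mu> *\<^sub>R a \<mu> r) \<le> (\<Sum>\<mu>\<in>supp w. w \<mu> *\<^sub>R a \<mu> r')" for r r'
      unfolding intL[OF w] using weight_coneD(5)[OF w] by (simp add: divide_le_cancel)
    have argmin: "{R w} = {r. \<forall>r'. (\<Sum>\<mu>\<in>supp w. w \<mu> *\<^sub>R a \<mu> r) \<le> (\<Sum>\<mu>\<in>supp w. w \<mu> *\<^sub>R a \<mu> r')}"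
      using L(2)[OF Q[OF w]] unfolding le R_def .
    show "(\<Sum>\<mu>\<in>supp w. w \<mu> *\<^sub>R a \<mu> (R w)) \<le> (\<Sum>\<mu>\<in>supp w. w \<mu> *\<^sub>R a \<mu> r)"
      using argmin by blast
    show "r = R w" if "\<And>r'. (\<Sum>\<mu>\<in>supp w. w \<mu> *\<^sub>R a \<mu> r) \<le> (\<Sum>\<mu>\<in>supp w. w \<mu> *\<^sub>R a \<mu> r')"
      using argmin that by blast
    show "R w = r \<longleftrightarrow> (\<Sum>\<mu>\<in>supp w. w \<mu> *\<^sub>R v \<mu> r) = 0"
      unfolding R_def V(2)[OF Q[OF w]] intV[OF w] using weight_coneD(5)[OF w] by simp
  qed
  have "I \<noteq> {}" by (simp add: I_def)
  then obtain q J where q: "q \<in> weight_cone I" and J: "J \<subseteq> supp q"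
    and ind: "indexed_independent (\<lambda>\<mu>. v \<mu> (R q)) J"
    and span: "\<And>g. g \<in> I \<Longrightarrow> \<exists>c. v g (R q) = (\<Sum>j\<in>J. c j *\<^sub>R v j (R q))"
    by (rule exists_spanning_weight) blast
  have finJ: "finite J" using J weight_coneD(1)[OF q] by (rule finite_subset)
  define m where "m = mode (mixture_measure q)"
  define D where "D \<mu> = normal_density_deriv \<mu> m" for \<mu>
  \<comment> \<open>The mode factors through \<open>Ghat\<close>, so all mixtures on the level of
    \<open>q\<close> share the mode \<open>m\<close>, which is a critical point of each of
    them.\<close>
  have critical: "(\<Sum>\<mu>\<in>supp w. w \<mu> *\<^sub>R D \<mu>) = 0" if w: "w \<in> weight_cone I" "R w = R q" for w
  proof -
    have "mode (mixture_measure w) = m"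
      using f[OF Q[OF w(1)]] f[OF Q[OF q]] w(2) by (simp add: R_def m_def)
    moreover have "\<exists>!x. is_mode (mixture_measure w) x"
      using mixture_unimodal[OF w(1)[unfolded I_def]] by (simp add: unimodal_def)
    then have "is_mode (mixture_measure w) (mode (mixture_measure w))"
      unfolding mode_def by (rule theI')
    ultimately show ?thesis using critical_point_of_mode[OF w(1)] by (simp add: D_def)
  qed
  \<comment> \<open>Subtracting the critical-point equations of \<open>q\<close> and of its
    perturbation transfers a linear relation among the vectors \<open>v j (R q)\<close> to the
    numbers \<open>D j\<close>.\<close>
  have D_span: "D g = (\<Sum>j\<in>J. c j * D j)"
    if g: "g \<in> I" and c: "v g (R q) = (\<Sum>j\<in>J. c j *\<^sub>R v j (R q))" for g c
  proof -
    obtain t w where t: "t > 0" and w: "w \<in> weight_cone I" "R w = R q"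
      and sw: "supp w \<subseteq> insert g (supp q)"
      and w_eq: "\<And>i. w i = q i + t * ((if i = g then 1 else 0) - (if i \<in> J then c i else 0))"
      using level_perturbation[OF q J g c] by blast
    let ?T = "insert g (supp q)"
    have T: "finite ?T" using weight_coneD(1)[OF q] by simp
    have TJ: "?T \<inter> {i. i \<in> J} = J" using J by auto
    have "0 = (\<Sum>i\<in>?T. w i *\<^sub>R D i)"
      using critical[OF w] sum_supp_superset[OF T sw, of D] by simp
    also have "\<dots> = (\<Sum>i\<in>?T. q i *\<^sub>R D i) +
        t * ((\<Sum>i\<in>?T. if i = g then D i else 0) - (\<Sum>i\<in>?T. if i \<in> J then c i * D i else 0))"
      unfolding sum_subtractf[symmetric] sum_distrib_left sum.distrib[symmetric]
      by (intro sum.cong) (auto simp: w_eq algebra_simps)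
    also have "(\<Sum>i\<in>?T. q i *\<^sub>R D i) = 0"
      using critical[OF q] sum_supp_superset[OF T subset_insertI, of D] by simp
    also have "(\<Sum>i\<in>?T. if i \<in> J then c i * D i else 0) = (\<Sum>j\<in>J. c j * D j)"
      using sum.inter_filter[OF T, of "\<lambda>i. c i * D i" "\<lambda>i. i \<in> J"] TJ by (simp add: Int_def)
    also have "(\<Sum>i\<in>?T. if i = g then D i else 0) = D g"
      using T by simp
    finally show ?thesis using t by simp
  qed
  define b where "b \<mu> = v \<mu> (R q)" for \<mu>
  have inj: "inj_on b J" and indep: "independent (b ` J)"
    using indexed_independent_inj_on[OF finJ ind] indexed_independent_independent[OF finJ ind]
    by (auto simp: b_def[abs_def])
  \<comment> \<open>The functional is prescribed only on the independent vectors \<open>b j\<close>.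
    By \<open>span\<close> and \<open>D_span\<close> it then sends \<open>v g (R q)\<close> to
    \<open>D g\<close> for every \<open>g\<close> in \<open>I\<close>.\<close>
  obtain l :: "real ^ 'k \<Rightarrow> real" where l: "linear l"
    and l_basis: "\<forall>y\<in>b ` J. l y = D (the_inv_into J b y)"
    using linear_independent_extend[OF indep, of "\<lambda>y. D (the_inv_into J b y)"]
    by (elim exE conjE) (rule that)
  have lb: "bounded_linear l" using l by (simp add: linear_conv_bounded_linear)
  \<comment> \<open>The functional commutes with expectation, so \<open>l (V (R q) y)\<close> is the
    function \<open>u\<close> whose existence is to be refuted.\<close>
  have "(\<integral>y. l (V (R q) y) \<partial>gaussian g) = normal_density_deriv g m" if g: "\<bar>g\<bar> < 1/2" for g
  proof -
    have gI: "g \<in> I" using g by (auto simp: I_def abs_less_iff)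
    then obtain c where c: "v g (R q) = (\<Sum>j\<in>J. c j *\<^sub>R v j (R q))" using span by blast
    have "(\<integral>y. l (V (R q) y) \<partial>gaussian g) = l (v g (R q))"
      unfolding v_def by (rule integral_bounded_linear[OF lb]) (rule V gaussian_in_class_Q)+
    also have "\<dots> = (\<Sum>j\<in>J. c j * l (b j))"
      unfolding c by (simp add: linear_sum[OF l] linear_cmul[OF l] b_def)
    also have "\<dots> = (\<Sum>j\<in>J. c j * D j)"
      using l_basis by (intro sum.cong) (simp_all add: the_inv_into_f_f[OF inj])
    also have "\<dots> = D g" using D_span[OF gI c] by simp
    finally show ?thesis by (simp add: D_def)
  qed
  moreover have "integrable (gaussian g) (\<lambda>y. l (V (R q) y))" for g
    by (rule integrable_bounded_linear[OF lb]) (rule V gaussian_in_class_Q)+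
  ultimately show False
    using normal_density_deriv_not_integral[of "\<lambda>y. l (V (R q) y)" "1/2" m] by force
qed

end
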